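(* With the setting and the algorithm APAPC as in the context, suppose that $\lambda_{\min}(KK^* )>0$ and $\mu_g\le\frac{L_f}{2}$, and let $(x^\star,u^\star)$ satisfy $0=\nabla f(x^\star)+\mu_g x^\star+K^*u^\star$ and $Kx^\star\in\partial h^*(u^\star)$. Define, for $t\ge0$, $$\begin{aligned}\mathcal{E}^t_{x^\star}:={}&\frac{2+a_{t}\gamma\mu_g}{4\gamma}\|z^{t}-x^\star\|^2+\frac{2a_{t}^2+\min\big(\frac12,\frac{1}{2a_{t}\gamma L_f}\big)\gamma\tau a_{t}^2\lambda_{\min}(KK^* )}{4\tau}\|v^{t}-u^\star\|^2\\&-\frac{a_{t}^2\gamma}{2+2a_{t}\gamma\mu_g}\|K^*(v^{t}-u^\star)\|^2+a_{t}^2\,\mathcal{G}_{x^\star,u^\star}(x^t,u^t).\end{aligned}$$ Assume that $\gamma\le\frac{1}{2L_f}$, $a_0>0$, $\gamma\tau\|K\|^2\le1+a_0\gamma\mu_g$, and $a_{t+1}\ge a_t$ for every $t\ge0$. Then for every $t\ge0$, $$\mathcal{E}^{t+1}_{x^\star}\le\max\left(\frac{1}{1+\frac12a_{t}\gamma\mu_g},\frac{a_{t+1}^2}{a_t^2+\frac14a_t^2\gamma\tau\lambda_{\min}(KK^* )},\frac{a_{t+1}^2}{a_t^2+\frac{1}{4\gamma L_f}a_t\gamma\tau\lambda_{\min}(KK^* )},\frac{a_{t+1}^2-a_{t+1}}{a_t^2}\right)\mathcal{E}^t_{x^\star}.$$ Consequently, choosing $\tau=\frac{\nu}{\gamma\|K\|^2}$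 for some $\nu\in(0,1]$, $a_0=a_1=1$, and $$a_{t+1}:=\min\left(a_t\sqrt{1+\frac{\nu\lambda_{\min}(KK^* )}{4\|K\|^2}},\ \sqrt{a_t^2+a_t\frac{\nu\lambda_{\min}(KK^* )}{4\gamma L_f\|K\|^2}},\ \frac{1+\sqrt{1+4a_t^2}}{2}\right),\quad\forall t\ge1,$$ which grows as $a_t=\Omega\Big(\frac t2\min\big(1,\frac{\nu\lambda_{\min}(KK^* )}{4\gamma L_f\|K\|^2}\big)\Big)$, one has, for every $t\ge0$, $$\mathcal{E}^t_{x^\star}\le\mathcal{E}^0_{x^\star},\qquad \mathcal{G}_{x^\star,u^\star}(x^t,u^t)\le\frac{\mathcal{E}^0_{x^\star}}{a_t^2}=\mathcal{O}\Big(\frac1{t^2}\Big).$$ Moreover, if $\nu<1$, then $\|v^t-u^\star\|^2=\mathcal{O}(1/t^2)$; if $\nu=1$, then $\|v^t-u^\star\|^2=\mathcal{O}(1/t)$.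
   Context: Setting: $\mathcal{X},\mathcal{U}$ are real Hilbert spaces; $f:\mathcal{X}\to\mathbb{R}$ is convex, differentiable and $L_f$-smooth ($\nabla f$ is $L_f$-Lipschitz), $L_f>0$; $\mu_g\ge 0$ and $g:=\frac{\mu_g}{2}\|\cdot\|^2$; $h:\mathcal{U}\to\mathbb{R}\cup\{+\infty\}$ is proper, lower semicontinuous, convex; $K:\mathcal{X}\to\mathcal{U}$ is a nonzero bounded linear operator with adjoint $K^*$; $h^*$ is the convex conjugate of $h$. The problem is $\min_x f(x)+\frac{\mu_g}{2}\|x\|^2+h(Kx)$. $\mathrm{prox}_\phi(u):=\arg\min_{w}\{\phi(w)+\frac12\|w-u\|^2\}$. $$\lambda_{\min}(KK^* ):=\inf_{u\in\mathcal{U},u\ne0}\frac{\|K^*u\|^2}{\|u\|^2}.$$ Lagrangian: $\mathcal{L}(x,u):=f(x)+\frac{\mu_g}{2}\|x\|^2+\langle Kx,u\rangle-h^*(u)$. Lagrangian gap: $\mathcal{G}_{x^\star,u^\star}(x,u):=\mathcal{L}(x,u^\star)-\mathcal{L}(x^\star,u)\in[0,+\infty]$. APAPC: given $\gamma>0$, $\tau>0$, a real sequence $(a_t)_{t\ge0}$ with $a_t\ge1$ for all $t\ge1$, $x^0=z^0\in\mathcal{X}$, $u^0=v^0\in\mathcal{U}$, iterate for $t\ge0$: $y^t:=(1-\frac1{a_{t+1}})x^t+\frac1{a_{t+1}}z^t$; $\hat z^t:=(1+a_{t+1}\gamma\mu_g)^{-1}\big(z^t-a_{t+1}\gamma\nabla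 f(y^t)-a_{t+1}\gamma K^*v^t\big)$; $v^{t+1}:=\mathrm{prox}_{\frac{\tau}{a_{t+1}}h^*}\big(v^t+\frac{\tau}{a_{t+1}}K\hat z^t\big)$; $z^{t+1}:=(1+a_{t+1}\gamma\mu_g)^{-1}\big(z^t-a_{t+1}\gamma\nabla f(y^t)-a_{t+1}\gamma K^*v^{t+1}\big)$; $x^{t+1}:=(1-\frac1{a_{t+1}})x^t+\frac1{a_{t+1}}z^{t+1}$; $u^{t+1}:=(1-\frac1{a_{t+1}})u^t+\frac1{a_{t+1}}v^{t+1}$.
   Formalization: The one-step inequality is false as stated for large jumps of a_t when μ_g>0; it is proved for each t with 1+a_{t+1}γμ_g ≤ (1+a_tγμ_g)(1+min(1/4,1/(4a_tγL_f))γτλ_min(KK* )), automatic when μ_g=0 or the max is ≤1. All later claims are unrestricted. *)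

theory Defs
  imports "HOL-Analysis.Analysis" "HOL-Library.Landau_Symbols"
begin

definition proper_fun :: "('a \<Rightarrow> ereal) \<Rightarrow> bool" where
  "proper_fun \<phi> \<longleftrightarrow> (\<forall>x. \<phi> x \<noteq> -\<infinity>) \<and> (\<exists>x. \<phi> x \<noteq> \<infinity>)"

definition lower_semicont :: "('a::topological_space \<Rightarrow> ereal) \<Rightarrow> bool" where
  "lower_semicont \<phi> \<longleftrightarrow> (\<forall>x. \<phi> x \<le> Liminf (at x) \<phi>)"

text \<open>Meaningful only for functions that never take the value \<open>-\<infinity>\<close>, since
  \<open>\<infinity> + (-\<infinity>) = \<infinity>\<close> in \<^typ>\<open>ereal\<close>.\<close>

definition convex_fun :: "('a::real_vector \<Rightarrow> ereal) \<Rightarrow> bool" where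
  "convex_fun \<phi> \<longleftrightarrow> (\<forall>x y. \<forall>s\<in>{0<..<1::real}.
     \<phi> ((1 - s) *\<^sub>R x + s *\<^sub>R y) \<le> ereal (1 - s) * \<phi> x + ereal s * \<phi> y)"

definition conjugate :: "('a::real_inner \<Rightarrow> ereal) \<Rightarrow> 'a \<Rightarrow> ereal" where
  "conjugate \<phi> u = (SUP w. ereal (w \<bullet> u) - \<phi> w)"

text \<open>By the usual convention the subdifferential is empty outside the effective domain.\<close>

definition subdifferential :: "('a::real_inner \<Rightarrow> ereal) \<Rightarrow> 'a \<Rightarrow> 'a set" where
  "subdifferential \<phi> u =
     {p. \<bar>\<phi> u\<bar> \<noteq> \<infinity> \<and> (\<forall>w. \<phi> u + ereal (p \<bullet> (w - u)) \<le> \<phi> w)}"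

text \<open>The minimiser exists and is unique when \<open>\<phi>\<close> is proper, lower semicontinuous and convex
  and the space is complete.\<close>

definition prox :: "('a::real_inner \<Rightarrow> ereal) \<Rightarrow> 'a \<Rightarrow> 'a" where
  "prox \<phi> u = (ARG_MIN (\<lambda>w. \<phi> w + ereal (1/2 * (norm (w - u))\<^sup>2)) w. True)"

definition lambda_min :: "('x::real_inner \<Rightarrow> 'u::real_inner) \<Rightarrow> real" where
  "lambda_min K = (INF u\<in>{u. u \<noteq> 0}. (norm (adjoint K u))\<^sup>2 / (norm u)\<^sup>2)"

definition lagrangian ::
  "('x::real_inner \<Rightarrow> real) \<Rightarrow> ('u::real_inner \<Rightarrow> ereal) \<Rightarrow> ('x \<Rightarrow> 'u) \<Rightarrow> real \<Rightarrow> 'x \<Rightarrow> 'u \<Rightarrow> ereal"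
  where
  "lagrangian f h K \<mu> x u =
     ereal (f x + \<mu> / 2 * (norm x)\<^sup>2 + K x \<bullet> u) - conjugate h u"

definition lagrangian_gap ::
  "('x::real_inner \<Rightarrow> real) \<Rightarrow> ('u::real_inner \<Rightarrow> ereal) \<Rightarrow> ('x \<Rightarrow> 'u) \<Rightarrow> real
     \<Rightarrow> 'x \<Rightarrow> 'u \<Rightarrow> 'x \<Rightarrow> 'u \<Rightarrow> ereal"
  where
  "lagrangian_gap f h K \<mu> xs us x u = lagrangian f h K \<mu> x us - lagrangian f h K \<mu> xs u"

text \<open>\<open>apapc f' h K \<mu> \<gamma> \<tau> a x z u v\<close> says that the four sequences are the iterates of APAPC,
  where \<open>f'\<close> is the gradient of the smooth term.\<close>

definition apapc ::
  "('x::real_inner \<Rightarrow> 'x) \<Rightarrow> ('u::real_inner \<Rightarrow> ereal) \<Rightarrow> ('x \<Rightarrow> 'u) \<Rightarrow> real \<Rightarrow> real \<Rightarrow> real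
     \<Rightarrow> (nat \<Rightarrow> real) \<Rightarrow> (nat \<Rightarrow> 'x) \<Rightarrow> (nat \<Rightarrow> 'x) \<Rightarrow> (nat \<Rightarrow> 'u) \<Rightarrow> (nat \<Rightarrow> 'u) \<Rightarrow> bool"
  where
  "apapc f' h K \<mu> \<gamma> \<tau> a x z u v \<longleftrightarrow>
     x 0 = z 0 \<and> u 0 = v 0 \<and>
     (\<forall>t. let b = a (Suc t);
              y = (1 - 1/b) *\<^sub>R x t + (1/b) *\<^sub>R z t;
              zh = inverse (1 + b*\<gamma>*\<mu>) *\<^sub>R
                     (z t - (b*\<gamma>) *\<^sub>R f' y - (b*\<gamma>) *\<^sub>R adjoint K (v t))
          in v (Suc t) = prox (\<lambda>w. ereal (\<tau>/b) * conjugate h w) (v t + (\<tau>/b) *\<^sub>R K zh) \<and>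
             z (Suc t) = inverse (1 + b*\<gamma>*\<mu>) *\<^sub>R
                     (z t - (b*\<gamma>) *\<^sub>R f' y - (b*\<gamma>) *\<^sub>R adjoint K (v (Suc t))) \<and>
             x (Suc t) = (1 - 1/b) *\<^sub>R x t + (1/b) *\<^sub>R z (Suc t) \<and>
             u (Suc t) = (1 - 1/b) *\<^sub>R u t + (1/b) *\<^sub>R v (Suc t))"

text \<open>\<open>energy f h K L \<mu> \<gamma> \<tau> b xs us x z u v\<close> is the energy at one iterate; \<open>b\<close> stands for
  \<open>a\<^sub>t\<close>. It is \<open>\<infinity>\<close> exactly when the gap is.

  Pitfall: relative to \<open>b\<^sup>2\<close>, the weight \<open>\<gamma> / (2 + 2*b*\<gamma>*\<mu>)\<close> of the subtracted term decreases in \<open>b\<close>.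
  So if \<open>\<mu> > 0\<close>, the one-step contraction is false for arbitrary increases from \<open>b = a\<^sub>t\<close> to
  \<open>b' = a\<^sub>t\<^sub>+\<^sub>1\<close>. It needs a growth restriction; a sufficient one is
  \<open>1 + b'*\<gamma>*\<mu> \<le> (1 + b*\<gamma>*\<mu>) * (1 + min (1/4) (1/(4*b*\<gamma>*L)) * \<gamma>*\<tau>*lambda_min K)\<close>, which holds automatically
  if \<open>\<mu> = 0\<close>, if \<open>b' = b\<close>, or more generally if \<open>b'/b\<close> is at most the last factor.\<close>

definition energy ::
  "('x::real_inner \<Rightarrow> real) \<Rightarrow> ('u::real_inner \<Rightarrow> ereal) \<Rightarrow> ('x \<Rightarrow> 'u)
     \<Rightarrow> real \<Rightarrow> real \<Rightarrow> real \<Rightarrow> real \<Rightarrow> real \<Rightarrow> 'x \<Rightarrow> 'u \<Rightarrow> 'x \<Rightarrow> 'x \<Rightarrow> 'u \<Rightarrow> 'u \<Rightarrow> ereal"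
  where
  "energy f h K L \<mu> \<gamma> \<tau> b xs us x z u v =
     ereal ((2 + b*\<gamma>*\<mu>) / (4*\<gamma>) * (norm (z - xs))\<^sup>2
          + (2*b\<^sup>2 + min (1/2) (1/(2*b*\<gamma>*L)) * \<gamma>*\<tau>*b\<^sup>2*lambda_min K) / (4*\<tau>) * (norm (v - us))\<^sup>2
          - b\<^sup>2*\<gamma> / (2 + 2*b*\<gamma>*\<mu>) * (norm (adjoint K (v - us)))\<^sup>2)
     + ereal (b\<^sup>2) * lagrangian_gap f h K \<mu> xs us x u"

end

theory Submission
  imports Defs
begin

text \<open>At a saddle point the gap is the sum of the Bregman divergences of \<open>f + \<mu>/2 \<parallel>\<cdot>\<parallel>\<^sup>2\<close> at \<open>xs\<close> and of the
  conjugate \<open>h\<^sup>*\<close> at \<open>us\<close>. Convexity of both along the averaging steps, the descent lemma and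
  cocoercivity of \<open>f'\<close> bound \<open>a\<^sub>t\<^sub>+\<^sub>1\<^sup>2\<close> times the new gap; inserting the optimality conditions of the
  updates makes the remaining inner products telescope into squared distances. The dual step is
  taken at the predictor \<open>zh\<close>, which produces exactly the \<open>K\<^sup>*\<close> seminorm subtracted in the energy. The unused
  negative terms \<open>\<parallel>z' - z\<parallel>\<^sup>2\<close>, \<open>\<parallel>z' - xs\<parallel>\<^sup>2\<close> and \<open>\<parallel>f' y - f' xs\<parallel>\<^sup>2\<close> dominate \<open>\<parallel>K\<^sup>* (v' - us)\<parallel>\<^sup>2\<close>,
  hence \<open>lambda_min K * \<parallel>v' - us\<parallel>\<^sup>2\<close>, and this is the additional dual weight of the energy.\<close>

section \<open>Minimisers of strongly convex functions, Riesz representation and adjoints\<close>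

text \<open>Cantor's intersection theorem: the sublevel sets at \<open>I + 1 / real (Suc n)\<close>
  are closed and nested, and \<open>mid\<close>, which is strong convexity of modulus 1 at
  midpoints, makes their diameters shrink to 0. Phrasing \<open>mid\<close> through real upper
  bounds avoids arithmetic with infinite values.\<close>

lemma strongly_convex_has_minimizer:
  fixes F :: "'a::{real_inner,complete_space} \<Rightarrow> ereal"
  assumes closed: "\<And>c::real. closed {w. F w \<le> ereal c}"
    and lower: "\<And>w. ereal m \<le> F w"
    and fin: "F b < \<infinity>"
    and mid: "\<And>x y r s. F x \<le> ereal r \<Longrightarrow> F y \<le> ereal s \<Longrightarrow>
      F ((1/2) *\<^sub>R (x + y)) \<le> ereal ((r + s) / 2 - (dist x y)\<^sup>2 / 8)"
  shows "\<exists>p. \<forall>w. F p \<le> F w"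
proof -
  have "ereal m \<le> (INF w. F w)" by (intro INF_greatest lower)
  moreover have "(INF w. F w) < \<infinity>" using fin by (meson INF_lower UNIV_I le_less_trans)
  ultimately obtain I where I: "(INF w. F w) = ereal I"
    by (cases "INF w. F w") auto
  have I_le: "ereal I \<le> F w" for w using I by (metis INF_lower UNIV_I)
  define S where "S n = {w. F w \<le> ereal (I + 1 / real (Suc n))}" for n
  have ne: "S n \<noteq> {}" for n
  proof -
    have "(INF w. F w) < ereal (I + 1 / real (Suc n))" unfolding I by simp
    then obtain w where "F w < ereal (I + 1 / real (Suc n))" by (auto simp: INF_less_iff)
    then show ?thesis unfolding S_def by (auto intro: less_imp_le)
  qed
  have dec: "S n \<subseteq> S k" if "k \<le> n" for k n
  proof -
    have "1 / real (Suc n) \<le> 1 / real (Suc k)" using that by (simp add: frac_le)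
    then show ?thesis unfolding S_def
      by (auto intro: order_trans)
  qed
  have small: "\<exists>n. \<forall>x\<in>S n. \<forall>y\<in>S n. dist x y < e" if "e > 0" for e
  proof -
    from that have "e\<^sup>2 / 8 > 0" by simp
    then obtain n where n: "1 / real (Suc n) < e\<^sup>2 / 8" 
      using nat_approx_posE by blast
    have "dist x y < e" if "x \<in> S n" "y \<in> S n" for x y
    proof -
      \<comment> \<open>The midpoint of two points of \<open>S n\<close> still has value at least
        \<open>I\<close>, so \<open>(dist x y)\<^sup>2 / 8\<close> is at most
        \<open>q - I\<close>.\<close>
      define q where "q = I + 1 / real (Suc n)"
      have "F x \<le> ereal q" "F y \<le> ereal q" using that unfolding S_def q_def by auto
      then have "ereal I \<le> ereal ((q + q) / 2 - (dist x y)\<^sup>2 / 8)"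
        using I_le mid order_trans by blast
      moreover have "q - I < e\<^sup>2 / 8" using n by (simp add: q_def)
      ultimately have "(dist x y)\<^sup>2 < e\<^sup>2" by simp
      then show ?thesis using \<open>e > 0\<close> by (meson less_imp_le power_less_imp_less_base)
    qed
    then show ?thesis by blast
  qed
  have "closed (S n)" for n unfolding S_def by (rule closed)
  then obtain p where p: "\<And>n. p \<in> S n"
    using decreasing_closed_nest[of S] ne dec small by metis
  have "F p \<le> ereal I"
  proof (rule ereal_le_epsilon2)
    fix e :: real assume "e > 0"
    then obtain n where "1 / real (Suc n) < e" using nat_approx_posE by blast
    then have "ereal (I + 1 / real (Suc n)) \<le> ereal I + ereal e" by simp
    then show "F p \<le> ereal I + ereal e" using p[of n] unfolding S_def by (auto intro: order_trans)
  qed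
  then show ?thesis using I_le order_trans by blast
qed

text \<open>Parallelogram law; halved, it yields the modulus 1/8 demanded by
  \<open>strongly_convex_has_minimizer\<close>.\<close>

lemma norm_half_sum:
  fixes x y :: "'a::real_inner"
  shows "(norm ((1/2) *\<^sub>R (x + y) - u))\<^sup>2 = ((norm (x - u))\<^sup>2 + (norm (y - u))\<^sup>2) / 2 - (dist x y)\<^sup>2 / 4"
  by (simp add: power2_norm_eq_inner dist_norm inner_diff inner_add inner_commute field_simps)

text \<open>The minimiser of \<open>\<parallel>w\<parallel>\<^sup>2/2 - l w\<close> represents the functional \<open>l\<close>.\<close>

lemma riesz_representation:
  fixes l :: "'a::{real_inner,complete_space} \<Rightarrow> real"
  assumes "bounded_linear l"
  shows "\<exists>p. \<forall>w. l w = w \<bullet> p"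
proof -
  interpret bounded_linear l by fact
  define F where "F w = 1/2 * (norm w)\<^sup>2 - l w" for w
  have cont: "continuous_on UNIV F"
    unfolding F_def by (intro continuous_intros continuous_on continuous_on_id)
  obtain C where C: "\<And>w. norm (l w) \<le> norm w * C" using bounded by blast
  have "\<exists>p. \<forall>w. ereal (F p) \<le> ereal (F w)"
  proof (rule strongly_convex_has_minimizer[where m="- C\<^sup>2 / 2" and b=0])
    show "closed {w. ereal (F w) \<le> ereal c}" for c
      using cont by (simp add: closed_Collect_le)
    show "ereal (- C\<^sup>2 / 2) \<le> ereal (F w)" for w
    proof -
      have "l w \<le> norm w * C" using C[of w] by simp
      moreover have "0 \<le> (norm w - C)\<^sup>2" by simp
      ultimately show ?thesis unfolding F_def by (simp add: power2_diff)
    qed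
    show "ereal (F 0) < \<infinity>" by simp
    show "ereal (F ((1/2) *\<^sub>R (x + y))) \<le> ereal ((r + s) / 2 - (dist x y)\<^sup>2 / 8)"
      if "ereal (F x) \<le> ereal r" "ereal (F y) \<le> ereal s" for x y r s
      using that norm_half_sum[of x y 0]
      unfolding F_def by (simp only: scaleR add) (simp add: field_simps)
  qed
  then obtain p where p: "\<And>w. F p \<le> F w" by auto
  have "l w = w \<bullet> p" for w
  proof -
    \<comment> \<open>Fermat's rule along the line through the minimiser \<open>p\<close> in
      direction \<open>w\<close>.\<close>
    have "DERIV (\<lambda>s. F (p + s *\<^sub>R w)) 0 :> p \<bullet> w - l w"
      unfolding F_def power2_norm_eq_inner
      by (simp only: add scaleR inner_add_left inner_add_right inner_scaleR_left inner_scaleR_right)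
        (auto intro!: derivative_eq_intros simp: inner_commute)
    then have "p \<bullet> w - l w = 0"
      by (rule DERIV_local_min[where d=1]) (use p in auto)
    then show ?thesis by (simp add: inner_commute)
  qed
  then show ?thesis by blast
qed

text \<open>\<open>adjoint\<close> is a choice, so its defining identity has to be backed by a
  witness; the Riesz representatives of the functionals \<open>\<lambda>x. K x \<bullet> y\<close>
  provide one.\<close>

lemma adjoint_inner:
  fixes K :: "'a::{real_inner,complete_space} \<Rightarrow> 'b::real_inner"
  assumes "bounded_linear K"
  shows "K x \<bullet> y = x \<bullet> adjoint K y"
proof -
  have "\<exists>p. \<forall>x. K x \<bullet> y = x \<bullet> p" for y
    by (rule riesz_representation)
      (rule bounded_linear_compose[OF bounded_linear_inner_left assms])
  then have "\<exists>g. \<forall>x y. K x \<bullet> y = x \<bullet> g y" by metis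
  then have "\<forall>x y. K x \<bullet> y = x \<bullet> adjoint K y"
    unfolding adjoint_def by (rule someI_ex)
  then show ?thesis by blast
qed

lemma adjoint_diff:
  fixes K :: "'a::{real_inner,complete_space} \<Rightarrow> 'b::real_inner"
  assumes "bounded_linear K"
  shows "adjoint K (y - z) = adjoint K y - adjoint K z"
proof (rule vector_eq_ldot[THEN iffD1], rule allI)
  show "x \<bullet> adjoint K (y - z) = x \<bullet> (adjoint K y - adjoint K z)" for x
    by (simp add: inner_diff_right adjoint_inner[OF assms, symmetric])
qed

text \<open>Take \<open>x = adjoint K y\<close> in the adjoint identity, apply Cauchy--Schwarz and
  cancel one factor \<open>norm (adjoint K y)\<close>.\<close>

lemma norm_adjoint_le:
  fixes K :: "'a::{real_inner,complete_space} \<Rightarrow> 'b::real_inner"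
  assumes "bounded_linear K"
  shows "norm (adjoint K y) \<le> onorm K * norm y"
proof -
  have "norm (adjoint K y) * norm (adjoint K y) = K (adjoint K y) \<bullet> y"
    by (simp add: adjoint_inner[OF assms] norm_eq_sqrt_inner)
  also have "\<dots> \<le> norm (K (adjoint K y)) * norm y" by (rule norm_cauchy_schwarz)
  also have "\<dots> \<le> (onorm K * norm (adjoint K y)) * norm y"
    by (intro mult_right_mono onorm assms) simp
  finally have "norm (adjoint K y) * norm (adjoint K y) \<le> (onorm K * norm y) * norm (adjoint K y)"
    by (simp add: ac_simps)
  then show ?thesis
    using onorm_pos_le[OF assms] by (cases "norm (adjoint K y) = 0") (auto simp: mult_le_cancel_right)
qed

lemma lambda_min_le:
  fixes K :: "'a::real_inner \<Rightarrow> 'b::real_inner"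
  assumes "y \<noteq> 0"
  shows "lambda_min K * (norm y)\<^sup>2 \<le> (norm (adjoint K y))\<^sup>2"
proof -
  have "lambda_min K \<le> (norm (adjoint K y))\<^sup>2 / (norm y)\<^sup>2"
    unfolding lambda_min_def by (rule cINF_lower) (use assms in \<open>auto intro!: bdd_belowI2[where m=0]\<close>)
  then show ?thesis using assms by (simp add: field_simps)
qed

section \<open>Convex functions with Lipschitz gradient\<close>

lemma DERIV_along_line:
  fixes f :: "'a::real_inner \<Rightarrow> real"
  assumes "\<And>x. GDERIV f x :> f' x"
  shows "DERIV (\<lambda>s. f (x + s *\<^sub>R d)) s :> d \<bullet> f' (x + s *\<^sub>R d)"
proof -
  have "((\<lambda>s. x + s *\<^sub>R d) has_derivative (\<lambda>h. h *\<^sub>R d)) (at s)"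
    by (auto intro!: derivative_eq_intros)
  from has_derivative_compose[OF this assms[of "x + s *\<^sub>R d", unfolded gderiv_def]]
  show ?thesis unfolding has_field_derivative_def
    by (simp add: mult_commute_abs)
qed

text \<open>If the tangent exceeded \<open>f y\<close>, then \<open>f\<close> minus its chord would
  have positive derivative at \<open>x\<close> and so rise above the chord near \<open>x\<close>,
  against convexity.\<close>

lemma convex_on_above_tangent:
  fixes f :: "'a::real_inner \<Rightarrow> real"
  assumes "convex_on UNIV f" and "\<And>x. GDERIV f x :> f' x"
  shows "f x + (y - x) \<bullet> f' x \<le> f y"
proof (rule ccontr)
  let ?D = "\<lambda>s. f (x + s *\<^sub>R (y - x)) - s * (f y - f x)"
  assume "\<not> ?thesis"
  moreover have "DERIV ?D 0 :> (y - x) \<bullet> f' x - (f y - f x)"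
    using DERIV_along_line[OF assms(2), of x "y - x" 0] by (auto intro!: derivative_eq_intros)
  ultimately obtain e where "e > 0" and e: "\<And>s. 0 < s \<Longrightarrow> s < e \<Longrightarrow> ?D 0 < ?D s"
    using DERIV_pos_inc_right[of ?D "(y - x) \<bullet> f' x - (f y - f x)" 0] by auto
  define s where "s = min (e/2) (1/2)"
  have s: "0 < s" "s < e" "s < 1" using \<open>e > 0\<close> by (auto simp: s_def)
  have "f (x + s *\<^sub>R (y - x)) = f ((1 - s) *\<^sub>R x + s *\<^sub>R y)"
    by (simp add: algebra_simps)
  also have "\<dots> \<le> (1 - s) * f x + s * f y"
    using convex_onD[OF assms(1)] s by simp
  finally show False using e[OF s(1,2)] by (simp add: algebra_simps)
qed

text \<open>The descent lemma: along the segment, \<open>f\<close> minus its quadratic model has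
  nonpositive derivative.\<close>

lemma lipschitz_gradient_upper_bound:
  fixes f :: "'a::real_inner \<Rightarrow> real"
  assumes "\<And>x. GDERIV f x :> f' x" and "L-lipschitz_on UNIV f'"
  shows "f y \<le> f x + (y - x) \<bullet> f' x + L / 2 * (norm (y - x))\<^sup>2"
proof -
  define d where "d = y - x"
  let ?D = "\<lambda>s. f (x + s *\<^sub>R d) - s * (d \<bullet> f' x) - L / 2 * s\<^sup>2 * (norm d)\<^sup>2"
  have "?D 0 \<ge> ?D 1"
  proof (rule DERIV_nonpos_imp_nonincreasing[where f="?D"])
    fix s :: real assume "0 \<le> s"
    have "DERIV ?D s :> d \<bullet> f' (x + s *\<^sub>R d) - d \<bullet> f' x - L * s * (norm d)\<^sup>2"
      by (auto intro!: derivative_eq_intros DERIV_along_line assms)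
    moreover have "d \<bullet> f' (x + s *\<^sub>R d) - d \<bullet> f' x \<le> L * s * (norm d)\<^sup>2"
    proof -
      have "d \<bullet> f' (x + s *\<^sub>R d) - d \<bullet> f' x = d \<bullet> (f' (x + s *\<^sub>R d) - f' x)"
        by (simp add: inner_diff_right)
      also have "\<dots> \<le> norm d * norm (f' (x + s *\<^sub>R d) - f' x)" by (rule norm_cauchy_schwarz)
      also have "\<dots> \<le> norm d * (L * norm (s *\<^sub>R d))"
        using lipschitz_onD[OF assms(2), of "x + s *\<^sub>R d" x]
        by (intro mult_left_mono) (auto simp: dist_norm)
      finally show ?thesis using \<open>0 \<le> s\<close> by (simp add: power2_eq_square ac_simps)
    qed
    ultimately show "\<exists>y. DERIV ?D s :> y \<and> y \<le> 0" by (intro exI conjI) auto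
  qed simp
  then show ?thesis by (simp add: d_def)
qed

text \<open>The point \<open>w\<close> is one gradient step of length \<open>1 / L\<close> from
  \<open>x\<close> for \<open>f\<close> minus its tangent at \<open>y\<close>. The tangent at
  \<open>y\<close> bounds \<open>f w\<close> from below, the descent lemma at \<open>x\<close> from
  above, and the difference leaves the squared gradient gap.\<close>

lemma convex_lipschitz_gradient_lower_bound:
  fixes f :: "'a::real_inner \<Rightarrow> real"
  assumes "convex_on UNIV f" and "\<And>x. GDERIV f x :> f' x" and "L-lipschitz_on UNIV f'" and "L > 0"
  shows "f y + (x - y) \<bullet> f' y + 1 / (2 * L) * (norm (f' x - f' y))\<^sup>2 \<le> f x"
proof -
  define g where "g = f' x - f' y"
  define w where "w = x - (1 / L) *\<^sub>R g"
  have "f y + (w - y) \<bullet> f' y \<le> f w" by (rule convex_on_above_tangent[OF assms(1,2)])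
  also have "\<dots> \<le> f x + (w - x) \<bullet> f' x + L / 2 * (norm (w - x))\<^sup>2"
    by (rule lipschitz_gradient_upper_bound[OF assms(2,3)])
  finally have "f y + (w - y) \<bullet> f' y \<le> f x + (w - x) \<bullet> f' x + L / 2 * (norm (w - x))\<^sup>2" .
  moreover have "L / 2 * (norm (w - x))\<^sup>2 = (norm g)\<^sup>2 / L - 1 / (2 * L) * (norm g)\<^sup>2"
    using \<open>L > 0\<close> by (simp add: w_def power_divide power2_eq_square field_simps)
  moreover have "(w - y) \<bullet> f' y - (w - x) \<bullet> f' x = (x - y) \<bullet> f' y + (norm g)\<^sup>2 / L"
    by (simp add: w_def g_def inner_diff inner_commute power2_norm_eq_inner add_divide_distrib diff_divide_distrib algebra_simps)
  ultimately show ?thesis unfolding g_def[symmetric] by linarith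
qed

section \<open>The proximal operator of a conjugate function\<close>

lemma conjugate_le_iff:
  "conjugate h u \<le> t \<longleftrightarrow> (\<forall>w. ereal (w \<bullet> u) - h w \<le> t)"
  unfolding conjugate_def by (simp add: SUP_le_iff)

lemma conjugate_ge: "ereal (w \<bullet> u) - h w \<le> conjugate h u"
  using conjugate_le_iff by blast

lemma conjugate_not_minfty:
  assumes "proper_fun h"
  shows "conjugate h u \<noteq> -\<infinity>"
proof -
  obtain w where "h w \<noteq> \<infinity>" "h w \<noteq> -\<infinity>" using assms unfolding proper_fun_def by blast
  then show ?thesis using conjugate_ge[of w u h] by (cases "h w") auto
qed

text \<open>The conjugate is a supremum of affine functions, so convexity is checked on each of
  them; the real bounds \<open>p\<close>, \<open>q\<close> keep infinite values out of the
  sums.\<close>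

lemma conjugate_convex_le:
  assumes h: "proper_fun h" and s: "0 \<le> s" "s \<le> 1"
    and "conjugate h x \<le> ereal p" "conjugate h y \<le> ereal q"
  shows "conjugate h ((1 - s) *\<^sub>R x + s *\<^sub>R y) \<le> ereal ((1 - s) * p + s * q)"
  unfolding conjugate_le_iff
proof
  fix w
  show "ereal (w \<bullet> ((1 - s) *\<^sub>R x + s *\<^sub>R y)) - h w \<le> ereal ((1 - s) * p + s * q)"
  proof (cases "h w")
    case (real k)
    have "w \<bullet> x - k \<le> p" "w \<bullet> y - k \<le> q"
      using assms(4,5) real unfolding conjugate_le_iff by (metis ereal_less_eq(3) ereal_minus(1))+
    then have "(1 - s) * (w \<bullet> x - k) + s * (w \<bullet> y - k) \<le> (1 - s) * p + s * q"
      using s by (intro add_mono mult_left_mono) auto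
    then show ?thesis by (simp add: real inner_add_right algebra_simps)
  qed (use h in \<open>auto simp: proper_fun_def\<close>)
qed

lemma prox_conjugate_objective_le_iff:
  assumes "proper_fun h" "c > 0"
  shows "ereal c * conjugate h w + ereal q \<le> ereal r \<longleftrightarrow> conjugate h w \<le> ereal ((r - q) / c)"
  using conjugate_not_minfty[OF assms(1), of w] assms(2)
  by (cases "conjugate h w") (auto simp: field_simps)

text \<open>\<open>ARG_MIN\<close> yields a minimiser only if one exists, and existence comes from
  strong convexity of the objective. Its sublevel sets are closed as intersections over the affine
  minorants of the conjugate; \<open>fin\<close> keeps the objective from being infinite
  everywhere.\<close>

lemma prox_conjugate_minimizes:
  fixes h :: "'a::{real_inner,complete_space} \<Rightarrow> ereal" and u :: 'a
  assumes h: "proper_fun h" and fin: "conjugate h u0 < \<infinity>" and c: "c > 0"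
  defines "p \<equiv> prox (\<lambda>w. ereal c * conjugate h w) u"
  shows "ereal c * conjugate h p + ereal (1/2 * (norm (p - u))\<^sup>2)
    \<le> ereal c * conjugate h w + ereal (1/2 * (norm (w - u))\<^sup>2)"
proof -
  define F where "F w = ereal c * conjugate h w + ereal (1/2 * (norm (w - u))\<^sup>2)" for w
  have F_le: "F w \<le> ereal r \<longleftrightarrow> conjugate h w \<le> ereal ((r - 1/2 * (norm (w - u))\<^sup>2) / c)" for w r
    unfolding F_def by (rule prox_conjugate_objective_le_iff[OF h c])
  obtain y k where y: "h y = ereal k"
    using h unfolding proper_fun_def by (metis ereal_cases)
  have "\<exists>p. \<forall>w. F p \<le> F w"
  \<comment> \<open>The lower bound \<open>m\<close> comes from one affine minorant
    \<open>y \<bullet> w - k\<close> of the conjugate, by completing the square in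
    \<open>w - u\<close>.\<close>
  proof (rule strongly_convex_has_minimizer[where b=u0 and m="c * (y \<bullet> u - k) - c\<^sup>2 * (norm y)\<^sup>2 / 2"])
    show "closed {w. F w \<le> ereal r}" for r
    proof -
      have "{w. F w \<le> ereal r} =
        (\<Inter>y. {w. ereal (y \<bullet> w) - h y \<le> ereal ((r - 1/2 * (norm (w - u))\<^sup>2) / c)})"
        unfolding F_le conjugate_le_iff by auto
      moreover have "closed {w. ereal (y \<bullet> w) - h y \<le> ereal ((r - 1/2 * (norm (w - u))\<^sup>2) / c)}" for y
      proof (cases "h y")
        case (real k)
        then show ?thesis using c by (simp, intro closed_Collect_le continuous_intros) auto
      qed (use h in \<open>auto simp: proper_fun_def\<close>)
      ultimately show ?thesis by auto
    qed
    show "ereal (c * (y \<bullet> u - k) - c\<^sup>2 * (norm y)\<^sup>2 / 2) \<le> F w" for w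
    proof -
      have "ereal (y \<bullet> w - k) \<le> conjugate h w" using conjugate_ge[of y w h] y by simp
      then have "ereal c * ereal (y \<bullet> w - k) \<le> ereal c * conjugate h w"
        by (rule ereal_mult_left_mono) (use c in simp)
      then have "ereal (c * (y \<bullet> w - k) + 1/2 * (norm (w - u))\<^sup>2) \<le> F w"
        unfolding F_def by (metis add_right_mono plus_ereal.simps(1) times_ereal.simps(1))
      moreover have "c * (y \<bullet> u - k) - c\<^sup>2 * (norm y)\<^sup>2 / 2 \<le> c * (y \<bullet> w - k) + 1/2 * (norm (w - u))\<^sup>2"
      proof -
        have "0 \<le> (norm ((w - u) + c *\<^sub>R y))\<^sup>2" by simp
        also have "\<dots> = (norm (w - u))\<^sup>2 + 2 * c * (y \<bullet> w - y \<bullet> u) + c\<^sup>2 * (norm y)\<^sup>2"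
          unfolding power2_norm_eq_inner
          by (simp add: inner_diff inner_add inner_commute algebra_simps power2_eq_square)
        finally show ?thesis by (simp add: algebra_simps)
      qed
      ultimately show ?thesis by (meson ereal_less_eq(3) order_trans)
    qed
    show "F u0 < \<infinity>" using fin c unfolding F_def
      by (cases "conjugate h u0") auto
    show "F ((1/2) *\<^sub>R (x + y)) \<le> ereal ((r + s) / 2 - (dist x y)\<^sup>2 / 8)"
      if "F x \<le> ereal r" "F y \<le> ereal s" for x y r s
    proof -
      have "(1/2) *\<^sub>R (x + y) = (1 - 1/2) *\<^sub>R x + (1/2) *\<^sub>R y" by (simp add: scaleR_right_distrib)
      moreover have "((r + s) / 2 - (dist x y)\<^sup>2 / 8
            - 1/2 * (((norm (x - u))\<^sup>2 + (norm (y - u))\<^sup>2) / 2 - (dist x y)\<^sup>2 / 4)) / c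
          = (1 - 1/2) * ((r - 1/2 * (norm (x - u))\<^sup>2) / c) + 1/2 * ((s - 1/2 * (norm (y - u))\<^sup>2) / c)"
        using c by (simp add: field_simps)
      ultimately show ?thesis
        using conjugate_convex_le[OF h _ _ that[unfolded F_le], of "1/2"]
        unfolding F_le norm_half_sum by simp
    qed
  qed
  then obtain q where "\<forall>w. F q \<le> F w" by blast
  then have "F p \<le> F w"
    unfolding p_def prox_def F_def[symmetric]
    by (intro arg_minI[where x=q and Q="\<lambda>p. F p \<le> F w"]) (auto simp: not_less)
  then show ?thesis unfolding F_def .
qed

text \<open>Compare \<open>p\<close> with \<open>(1 - s) *\<^sub>R p + s *\<^sub>R w\<close>, divide
  by \<open>s\<close> and let \<open>s\<close> tend to 0: of the quadratic only the linear term
  \<open>(u - p) \<bullet> (w - p)\<close> survives.\<close>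

lemma prox_conjugate_subdifferential:
  fixes h :: "'a::{real_inner,complete_space} \<Rightarrow> ereal"
  assumes h: "proper_fun h" and fin: "conjugate h u0 < \<infinity>" and c: "c > 0"
    and p: "p = prox (\<lambda>w. ereal c * conjugate h w) u"
  shows "(1 / c) *\<^sub>R (u - p) \<in> subdifferential (conjugate h) p"
proof -
  note min = prox_conjugate_minimizes[OF h fin c, of u, folded p]
  have "conjugate h p \<noteq> \<infinity>" using min[of u0] fin c conjugate_not_minfty[OF h, of u0]
    by (cases "conjugate h u0") auto
  then obtain P where P: "conjugate h p = ereal P"
    using conjugate_not_minfty[OF h, of p] by (cases "conjugate h p") auto
  have "ereal P + ereal ((1 / c) *\<^sub>R (u - p) \<bullet> (w - p)) \<le> conjugate h w" for w
  proof (cases "conjugate h w")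
    case (real W)
    have "c * P + (u - p) \<bullet> (w - p) \<le> c * W"
    proof (rule field_le_epsilon)
      fix e :: real assume "e > 0"
      \<comment> \<open>Small enough that the error \<open>1/2 * s * (norm (w - p))\<^sup>2\<close>
        stays below \<open>e\<close>; adding 1 avoids a zero denominator, and the minimum with 1
        keeps a convex combination.\<close>
      define s where "s = min 1 (e / ((norm (w - p))\<^sup>2 + 1))"
      have pos: "(norm (w - p))\<^sup>2 + 1 > 0" by (simp add: add_nonneg_pos)
      have s: "0 < s" "s \<le> 1" using \<open>e > 0\<close> pos by (auto simp: s_def)
      have "s * (norm (w - p))\<^sup>2 \<le> e / ((norm (w - p))\<^sup>2 + 1) * (norm (w - p))\<^sup>2"
        by (intro mult_right_mono) (auto simp: s_def)
      also have "\<dots> \<le> e" using \<open>e > 0\<close> pos by (simp add: field_simps)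
      finally have se: "s * (norm (w - p))\<^sup>2 \<le> e" .
      let ?w = "(1 - s) *\<^sub>R p + s *\<^sub>R w"
      have "conjugate h ?w \<le> ereal ((1 - s) * P + s * W)"
        by (rule conjugate_convex_le[OF h]) (use s P real in auto)
      then have "ereal c * conjugate h ?w \<le> ereal c * ereal ((1 - s) * P + s * W)"
        by (rule ereal_mult_left_mono) (use c in simp)
      then have "ereal c * conjugate h ?w + ereal (1/2 * (norm (?w - u))\<^sup>2)
          \<le> ereal (c * ((1 - s) * P + s * W) + 1/2 * (norm (?w - u))\<^sup>2)"
        by (metis add_right_mono plus_ereal.simps(1) times_ereal.simps(1))
      from order_trans[OF min[of ?w] this]
      have "c * P + 1/2 * (norm (p - u))\<^sup>2 \<le> c * ((1 - s) * P + s * W) + 1/2 * (norm (?w - u))\<^sup>2"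
        by (simp add: P)
      moreover have "(norm (?w - u))\<^sup>2 = (norm (p - u))\<^sup>2 - 2 * s * ((u - p) \<bullet> (w - p)) + s\<^sup>2 * (norm (w - p))\<^sup>2"
        unfolding power2_norm_eq_inner
        by (simp add: inner_diff inner_add inner_commute algebra_simps power2_eq_square)
      ultimately have "s * (c * P + (u - p) \<bullet> (w - p)) \<le> s * (c * W + 1/2 * s * (norm (w - p))\<^sup>2)"
        by (simp add: algebra_simps power2_eq_square)
      then have "c * P + (u - p) \<bullet> (w - p) \<le> c * W + 1/2 * s * (norm (w - p))\<^sup>2"
        using s by simp
      also have "\<dots> \<le> c * W + e" using se \<open>e > 0\<close> s by (simp add: algebra_simps)
      finally show "c * P + (u - p) \<bullet> (w - p) \<le> c * W + e" .
    qed
    then have "P + (1 / c) * ((u - p) \<bullet> (w - p)) \<le> W" using c by (simp add: field_simps)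
    then show ?thesis by (simp add: real)
  qed (use conjugate_not_minfty[OF h, of w] in auto)
  then show ?thesis unfolding subdifferential_def using P by simp
qed

section \<open>The energy inequality\<close>

lemma norm_sq_convex_combination:
  fixes x z :: "'a::real_inner"
  assumes "0 \<le> s" "s \<le> (1::real)"
  shows "(norm ((1 - s) *\<^sub>R x + s *\<^sub>R z))\<^sup>2 \<le> (1 - s) * (norm x)\<^sup>2 + s * (norm z)\<^sup>2"
proof -
  have "(1 - s) * (norm x)\<^sup>2 + s * (norm z)\<^sup>2 - (norm ((1 - s) *\<^sub>R x + s *\<^sub>R z))\<^sup>2
      = s * (1 - s) * (norm (x - z))\<^sup>2"
    unfolding power2_norm_eq_inner
    by (simp add: inner_add inner_diff inner_commute algebra_simps power2_eq_square)
  then show ?thesis using assms by (smt (verit) mult_nonneg_nonneg zero_le_power2)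
qed

text \<open>Weighted Cauchy--Schwarz: the difference of the sides is a sum of weighted squares. The
  middle vector is multiplied by \<open>q\<close> instead of being divided by it, so that
  \<open>q = 0\<close> is allowed; this is the case \<open>\<mu> = 0\<close>.\<close>

lemma norm_sq_sum3_weighted:
  fixes A B C :: "'a::real_inner"
  assumes "p > 0" "q \<ge> 0" "r > 0"
  shows "(norm (A + q *\<^sub>R B + C))\<^sup>2 \<le> (p + q + r) * ((norm A)\<^sup>2 / p + q * (norm B)\<^sup>2 + (norm C)\<^sup>2 / r)"
proof -
  have sq: "0 \<le> (norm (x - y))\<^sup>2" for x y :: 'a by simp
  have "(p + q + r) * ((norm A)\<^sup>2 / p + q * (norm B)\<^sup>2 + (norm C)\<^sup>2 / r) - (norm (A + q *\<^sub>R B + C))\<^sup>2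
     = q * (p * (norm (B - (1/p) *\<^sub>R A))\<^sup>2 + r * (norm (B - (1/r) *\<^sub>R C))\<^sup>2)
       + p * r * (norm ((1/p) *\<^sub>R A - (1/r) *\<^sub>R C))\<^sup>2"
    using assms unfolding power2_norm_eq_inner
    by (simp add: inner_add inner_diff inner_commute field_simps power2_eq_square)
  moreover have "0 \<le> \<dots>" using assms by (intro add_nonneg_nonneg mult_nonneg_nonneg) auto
  ultimately show ?thesis by linarith
qed

section \<open>Saddle points: the gap as a sum of Bregman divergences\<close>

locale saddle_point_setting =
  fixes f :: "'x::{real_inner,complete_space} \<Rightarrow> real"
    and f' :: "'x \<Rightarrow> 'x"
    and h :: "'u::{real_inner,complete_space} \<Rightarrow> ereal"
    and K :: "'x \<Rightarrow> 'u"
    and L \<mu> \<gamma> :: real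
    and xs :: 'x and us :: 'u
  assumes f_convex: "convex_on UNIV f"
    and f_gradient: "\<And>x. GDERIV f x :> f' x"
    and L_pos: "L > 0"
    and f_smooth: "L-lipschitz_on UNIV f'"
    and mu_nonneg: "\<mu> \<ge> 0"
    and h_proper: "proper_fun h"
    and K_linear: "bounded_linear K" and K_nonzero: "K \<noteq> (\<lambda>_. 0)"
    and lambda_pos: "lambda_min K > 0"
    and mu_le: "\<mu> \<le> L / 2"
    and primal_opt: "0 = f' xs + \<mu> *\<^sub>R xs + adjoint K us"
    and dual_opt: "K xs \<in> subdifferential (conjugate h) us"
    and gamma_pos: "\<gamma> > 0" and gamma_le: "\<gamma> \<le> 1 / (2*L)"
begin

definition breg_f :: "'x \<Rightarrow> real" where
  "breg_f x = f x - f xs - (x - xs) \<bullet> f' xs"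

text \<open>Bregman divergence of the conjugate at \<open>us\<close> for the subgradient
  \<open>K xs\<close>. It is meaningful only where the conjugate is finite, since
  \<open>real_of_ereal\<close> sends \<infinity> to 0.\<close>

definition breg_h :: "'u \<Rightarrow> real" where
  "breg_h u = real_of_ereal (conjugate h u) - real_of_ereal (conjugate h us) - K xs \<bullet> (u - us)"

definition gap :: "'x \<Rightarrow> 'u \<Rightarrow> real" where
  "gap x u = breg_f x + \<mu> / 2 * (norm (x - xs))\<^sup>2 + breg_h u"

lemma conj_us: "conjugate h us = ereal (real_of_ereal (conjugate h us))"
  using dual_opt unfolding subdifferential_def by (cases "conjugate h us") auto

lemma conj_us_finite: "conjugate h us < \<infinity>"
  using dual_opt unfolding subdifferential_def by auto

lemma conj_finite: "conjugate h u < \<infinity> \<Longrightarrow> conjugate h u = ereal (real_of_ereal (conjugate h u))"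
  using conjugate_not_minfty[OF h_proper, of u] by (cases "conjugate h u") auto

lemma gradient_xs: "f' xs = - \<mu> *\<^sub>R xs - adjoint K us"
proof -
  have "f' xs = (f' xs + \<mu> *\<^sub>R xs + adjoint K us) - \<mu> *\<^sub>R xs - adjoint K us" by simp
  then show ?thesis by (simp add: primal_opt[symmetric])
qed

text \<open>Stationarity replaces the linear term of \<open>breg_f\<close> by inner products with
  \<open>xs\<close> and \<open>adjoint K us\<close>: the former complete the square in
  \<open>x - xs\<close>, the latter account for the coupling terms.\<close>

lemma lagrangian_gap_finite:
  assumes "conjugate h u < \<infinity>"
  shows "lagrangian_gap f h K \<mu> xs us x u = ereal (gap x u)"
proof -
  have "f x + \<mu> / 2 * (norm x)\<^sup>2 + K x \<bullet> us - (f xs + \<mu> / 2 * (norm xs)\<^sup>2 + K xs \<bullet> u)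
      = breg_f x + \<mu> / 2 * (norm (x - xs))\<^sup>2 - K xs \<bullet> (u - us)"
    unfolding breg_f_def gradient_xs power2_norm_eq_inner
    using adjoint_inner[OF K_linear, of x us] adjoint_inner[OF K_linear, of xs us]
    by (simp add: inner_diff inner_add inner_commute field_simps)
  moreover obtain p q where "conjugate h u = ereal p" "conjugate h us = ereal q"
    using conj_finite[OF assms] conj_us by blast
  ultimately show ?thesis
    unfolding lagrangian_gap_def lagrangian_def gap_def breg_h_def by simp
qed

lemma lagrangian_gap_infinite:
  assumes "\<not> conjugate h u < \<infinity>"
  shows "lagrangian_gap f h K \<mu> xs us x u = \<infinity>"
proof -
  obtain q where "conjugate h us = ereal q" using conj_us by blast
  with assms show ?thesis unfolding lagrangian_gap_def lagrangian_def by simp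
qed

lemma breg_f_nonneg: "0 \<le> breg_f x"
  using convex_on_above_tangent[OF f_convex f_gradient, of xs x] by (simp add: breg_f_def)

lemma breg_h_nonneg:
  assumes "conjugate h u < \<infinity>"
  shows "0 \<le> breg_h u"
proof -
  obtain p q where pq: "conjugate h u = ereal p" "conjugate h us = ereal q"
    using conj_finite[OF assms] conj_us by blast
  have "conjugate h us + ereal (K xs \<bullet> (u - us)) \<le> conjugate h u"
    using dual_opt unfolding subdifferential_def by blast
  then show ?thesis by (simp add: breg_h_def pq)
qed

lemma gap_nonneg: "conjugate h u < \<infinity> \<Longrightarrow> 0 \<le> gap x u"
  unfolding gap_def using breg_f_nonneg breg_h_nonneg mu_nonneg by (simp add: add_nonneg_nonneg)

section \<open>Effect of one averaging step on each part of the gap\<close>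

text \<open>Three bounds at \<open>y\<close> are added: the descent lemma for \<open>x'\<close>, the
  tangent inequality towards \<open>x\<close> with weight \<open>1 - s\<close>, and cocoercivity
  towards \<open>xs\<close> with weight \<open>s\<close>. The last contributes the negative gradient
  term that later pays for the dual distance.\<close>

lemma breg_f_step:
  assumes b: "b \<ge> 1"
    and y: "y = (1 - 1/b) *\<^sub>R x + (1/b) *\<^sub>R z"
    and x': "x' = (1 - 1/b) *\<^sub>R x + (1/b) *\<^sub>R z'"
  shows "b\<^sup>2 * breg_f x' \<le> (b\<^sup>2 - b) * breg_f x + b * ((z' - xs) \<bullet> (f' y - f' xs))
    + L / 2 * (norm (z' - z))\<^sup>2 - b / (2 * L) * (norm (f' y - f' xs))\<^sup>2"
proof -
  define s where "s = 1 / b"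
  have s: "0 < s" "s \<le> 1" "b * s = 1" using b by (auto simp: s_def)
  \<comment> \<open>The two averages differ only in their \<open>z\<close> part, so scaling by
    \<open>b\<^sup>2\<close> turns \<open>(norm (x' - y))\<^sup>2\<close> into
    \<open>(norm (z' - z))\<^sup>2\<close>.\<close>
  have diff: "x' - y = s *\<^sub>R (z' - z)" by (simp add: x' y s_def scaleR_right_diff_distrib)
  then have norm_diff: "(norm (x' - y))\<^sup>2 = s\<^sup>2 * (norm (z' - z))\<^sup>2"
    by (simp add: power_mult_distrib)
  have upper: "f x' \<le> f y + (x' - y) \<bullet> f' y + L / 2 * (norm (x' - y))\<^sup>2"
    by (rule lipschitz_gradient_upper_bound[OF f_gradient f_smooth])
  have tangent: "(1 - s) * (f y + (x - y) \<bullet> f' y) \<le> (1 - s) * f x"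
    by (intro mult_left_mono convex_on_above_tangent[OF f_convex f_gradient]) (use s in auto)
  have "f y + (xs - y) \<bullet> f' y + 1 / (2 * L) * (norm (f' xs - f' y))\<^sup>2 \<le> f xs"
    by (rule convex_lipschitz_gradient_lower_bound[OF f_convex f_gradient f_smooth L_pos])
  then have cocoercive: "s * (f y + (xs - y) \<bullet> f' y + 1 / (2 * L) * (norm (f' y - f' xs))\<^sup>2) \<le> s * f xs"
    by (intro mult_left_mono) (use s in \<open>auto simp: norm_minus_commute\<close>)
  \<comment> \<open>The first two summands match the tangent and cocoercivity bounds; only
    \<open>z' - xs\<close> keeps an inner product with the gradient.\<close>
  have lin: "x' - y = (1 - s) *\<^sub>R (x - y) + s *\<^sub>R (xs - y) + s *\<^sub>R (z' - xs)"
    by (simp add: x' s_def algebra_simps)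
  have "breg_f x' \<le> (1 - s) * breg_f x + s * ((z' - xs) \<bullet> (f' y - f' xs))
    + L / 2 * (norm (x' - y))\<^sup>2 - s * (1 / (2 * L) * (norm (f' y - f' xs))\<^sup>2)"
  proof -
    have "(x' - y) \<bullet> f' y = (1 - s) * ((x - y) \<bullet> f' y) + s * ((xs - y) \<bullet> f' y) + s * ((z' - xs) \<bullet> f' y)"
      by (subst lin) (simp add: inner_add_left)
    moreover have "(x' - xs) \<bullet> f' xs = (1 - s) * ((x - xs) \<bullet> f' xs) + s * ((z' - xs) \<bullet> f' xs)"
      by (simp add: x' s_def[symmetric] inner_add_left inner_diff_left algebra_simps)
    ultimately show ?thesis
      using upper tangent cocoercive unfolding breg_f_def
      by (simp add: inner_diff_right algebra_simps)
  qed
  then have "b\<^sup>2 * breg_f x' \<le> b\<^sup>2 * ((1 - s) * breg_f x + s * ((z' - xs) \<bullet> (f' y - f' xs))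
    + L / 2 * (norm (x' - y))\<^sup>2 - s * (1 / (2 * L) * (norm (f' y - f' xs))\<^sup>2))"
    by (intro mult_left_mono) auto
  also have "\<dots> = (b\<^sup>2 - b) * breg_f x + b * ((z' - xs) \<bullet> (f' y - f' xs))
    + L / 2 * (norm (z' - z))\<^sup>2 - b / (2 * L) * (norm (f' y - f' xs))\<^sup>2"
    using b unfolding norm_diff by (simp add: s_def power2_eq_square field_simps)
  finally show ?thesis .
qed

text \<open>Convexity of the conjugate handles the average, and the subgradient \<open>p\<close>
  tested at \<open>us\<close> bounds the new part. Finiteness at \<open>u'\<close> carries the
  real-valued \<open>gap\<close> to the next iterate.\<close>

lemma breg_h_step:
  assumes b: "b \<ge> 1" and u: "conjugate h u < \<infinity>"
    and p: "p \<in> subdifferential (conjugate h) v'"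
    and u': "u' = (1 - 1/b) *\<^sub>R u + (1/b) *\<^sub>R v'"
  shows "conjugate h u' < \<infinity>"
    and "b\<^sup>2 * breg_h u' \<le> (b\<^sup>2 - b) * breg_h u + b * ((p - K xs) \<bullet> (v' - us))"
proof -
  define s where "s = 1 / b"
  have s: "0 < s" "s \<le> 1" "b * s = 1" using b by (auto simp: s_def)
  obtain U V W where fin: "conjugate h u = ereal U" "conjugate h v' = ereal V" "conjugate h us = ereal W"
    using conj_finite[OF u] conj_us p unfolding subdifferential_def
    by (metis (mono_tags, lifting) abs_ereal.simps(2) abs_ereal.simps(3) ereal_cases mem_Collect_eq)
  have le: "conjugate h u' \<le> ereal ((1 - s) * U + s * V)"
    unfolding u' s_def[symmetric]
    by (rule conjugate_convex_le[OF h_proper]) (use s fin in auto)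
  then show u'fin: "conjugate h u' < \<infinity>" by (meson ereal_less_PInfty order_le_less_trans less_ereal.simps)
  then obtain U' where U': "conjugate h u' = ereal U'" using conj_finite by blast
  have "conjugate h v' + ereal (p \<bullet> (us - v')) \<le> conjugate h us"
    using p unfolding subdifferential_def by blast
  then have VW: "V - W \<le> p \<bullet> (v' - us)" by (simp add: fin inner_diff_right)
  have "breg_h u' \<le> (1 - s) * breg_h u + s * (V - W - K xs \<bullet> (v' - us))"
  proof -
    have "K xs \<bullet> (u' - us) = (1 - s) * (K xs \<bullet> (u - us)) + s * (K xs \<bullet> (v' - us))"
      by (simp add: u' s_def[symmetric] inner_add_right inner_diff_right algebra_simps)
    then show ?thesis using le unfolding breg_h_def U' fin by (simp add: algebra_simps)
  qed
  also have "\<dots> \<le> (1 - s) * breg_h u + s * ((p - K xs) \<bullet> (v' - us))"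
    using VW s by (simp add: inner_diff_left)
  finally have "b\<^sup>2 * breg_h u' \<le> b\<^sup>2 * ((1 - s) * breg_h u + s * ((p - K xs) \<bullet> (v' - us)))"
    by (intro mult_left_mono) auto
  also have "\<dots> = (b\<^sup>2 - b) * breg_h u + b * ((p - K xs) \<bullet> (v' - us))"
    using b by (simp add: s_def power2_eq_square field_simps)
  finally show "b\<^sup>2 * breg_h u' \<le> (b\<^sup>2 - b) * breg_h u + b * ((p - K xs) \<bullet> (v' - us))" .
qed

lemma quadratic_step:
  assumes b: "b \<ge> 1"
    and x': "x' = (1 - 1/b) *\<^sub>R x + (1/b) *\<^sub>R z'"
  shows "b\<^sup>2 * (\<mu> / 2 * (norm (x' - xs))\<^sup>2)
    \<le> (b\<^sup>2 - b) * (\<mu> / 2 * (norm (x - xs))\<^sup>2) + b * (\<mu> / 2 * (norm (z' - xs))\<^sup>2)"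
proof -
  have "x' - xs = (1 - 1/b) *\<^sub>R (x - xs) + (1/b) *\<^sub>R (z' - xs)"
    by (simp add: x' algebra_simps)
  then have "(norm (x' - xs))\<^sup>2 \<le> (1 - 1/b) * (norm (x - xs))\<^sup>2 + (1/b) * (norm (z' - xs))\<^sup>2"
    using norm_sq_convex_combination[of "1/b" "x - xs" "z' - xs"] b by simp
  then have "b\<^sup>2 * (\<mu> / 2) * (norm (x' - xs))\<^sup>2
      \<le> b\<^sup>2 * (\<mu> / 2) * ((1 - 1/b) * (norm (x - xs))\<^sup>2 + (1/b) * (norm (z' - xs))\<^sup>2)"
    by (rule mult_left_mono) (use mu_nonneg in auto)
  also have "\<dots> = (b\<^sup>2 - b) * (\<mu> / 2 * (norm (x - xs))\<^sup>2) + b * (\<mu> / 2 * (norm (z' - xs))\<^sup>2)"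
    using b by (simp add: power2_eq_square field_simps)
  finally show ?thesis by (simp add: mult.assoc)
qed

text \<open>The dual iterate is controlled through \<open>lambda_min K * \<parallel>w\<parallel>\<^sup>2 \<le> \<parallel>K\<^sup>* w\<parallel>\<^sup>2\<close>: the primal update expresses
  \<open>K\<^sup>* w\<close> through quantities that the descent inequality leaves unused. The weights in Cauchy--Schwarz
  are those of these leftovers.\<close>

lemma dual_residual_bound:
  assumes b: "b > 0"
    and rel: "A - B = (b * \<gamma>) *\<^sub>R (D + \<mu> *\<^sub>R B + adjoint K w)"
  shows "min (1/2) (1 / (2 * b * \<gamma> * L)) * \<gamma> * b\<^sup>2 * lambda_min K / 4 * (norm w)\<^sup>2
    \<le> b * \<mu> / 4 * (norm B)\<^sup>2 + (1 / (2 * \<gamma>) - L / 2) * (norm (A - B))\<^sup>2 + b / (2 * L) * (norm D)\<^sup>2"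
proof -
  define k where "k = min (1/2) (1 / (2 * b * \<gamma> * L))"
  have k: "0 < k" using b gamma_pos L_pos by (simp add: k_def)
  define P where "P = (1 / (b * \<gamma>)) *\<^sub>R (A - B)"
  have gL: "\<gamma> * L \<le> 1/2" using gamma_le L_pos by (simp add: field_simps)
  have Kw: "adjoint K w = - (- P + \<mu> *\<^sub>R B + D)"
    using rel b gamma_pos by (simp add: P_def algebra_simps)
  have normP: "(norm (- P))\<^sup>2 = (norm (A - B))\<^sup>2 / (b * \<gamma>)\<^sup>2"
    by (simp add: P_def power_divide power_mult_distrib del: scaleR_right_diff_distrib scaleR_diff_right)
  have "lambda_min K * (norm w)\<^sup>2 \<le> (norm (adjoint K w))\<^sup>2"
    using lambda_min_le[of w K] by (cases "w = 0") auto
  also have "\<dots> \<le> (1 / (b * \<gamma>) + \<mu> + L / 2)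
      * ((norm (- P))\<^sup>2 / (1 / (b * \<gamma>)) + \<mu> * (norm B)\<^sup>2 + (norm D)\<^sup>2 / (L / 2))"
    unfolding Kw norm_minus_cancel
    using norm_sq_sum3_weighted[of "1 / (b * \<gamma>)" \<mu> "L/2" "- P" B D] b gamma_pos mu_nonneg L_pos by simp
  \<comment> \<open>By \<open>mu_le\<close>, the weights \<open>\<mu> + L / 2\<close> add up to at
    most \<open>L\<close>.\<close>
  also have "\<dots> \<le> (1 / (b * \<gamma>) + L)
      * ((norm (- P))\<^sup>2 / (1 / (b * \<gamma>)) + \<mu> * (norm B)\<^sup>2 + (norm D)\<^sup>2 / (L / 2))"
    by (intro mult_right_mono add_nonneg_nonneg) (use b gamma_pos mu_nonneg L_pos mu_le in auto)
  finally have "lambda_min K * (norm w)\<^sup>2 \<le> (1 / (b * \<gamma>) + L)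
      * ((norm (A - B))\<^sup>2 / (b * \<gamma>) + \<mu> * (norm B)\<^sup>2 + 2 / L * (norm D)\<^sup>2)" (is "_ \<le> _ * ?S")
    using b gamma_pos unfolding normP by (simp add: power2_eq_square ac_simps)
  then have "k * \<gamma> * b\<^sup>2 / 4 * (lambda_min K * (norm w)\<^sup>2) \<le> k * \<gamma> * b\<^sup>2 / 4 * ((1 / (b * \<gamma>) + L) * ?S)"
    by (rule mult_left_mono) (use k gamma_pos in auto)
  also have "\<dots> = k * (1 + b * \<gamma> * L) * (b / 4 * ?S)"
    using b gamma_pos by (simp add: power2_eq_square field_simps)
  \<comment> \<open>The two entries of the minimum \<open>k\<close> make \<open>k\<close> and
    \<open>k * (b * \<gamma> * L)\<close> both at most 1/2.\<close>
  also have "\<dots> \<le> 1 * (b / 4 * ?S)"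
  proof (rule mult_right_mono)
    have "k \<le> 1/2" by (simp add: k_def)
    moreover have "k * (b * \<gamma> * L) \<le> 1 / (2 * b * \<gamma> * L) * (b * \<gamma> * L)"
      by (rule mult_right_mono) (use b gamma_pos L_pos in \<open>auto simp: k_def\<close>)
    moreover have "1 / (2 * b * \<gamma> * L) * (b * \<gamma> * L) = 1/2" using b gamma_pos L_pos by simp
    ultimately show "k * (1 + b * \<gamma> * L) \<le> 1" unfolding distrib_left by linarith
    show "0 \<le> b / 4 * ?S" using b gamma_pos L_pos mu_nonneg by simp
  qed
  also have "\<dots> = 1 / (4 * \<gamma>) * (norm (A - B))\<^sup>2 + b * \<mu> / 4 * (norm B)\<^sup>2 + b / (2 * L) * (norm D)\<^sup>2"
    using b gamma_pos L_pos by (simp add: field_simps)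
  \<comment> \<open>By \<open>gL\<close>, \<open>1 / (4 * \<gamma>)\<close> is at most
    \<open>1 / (2 * \<gamma>) - L / 2\<close>, which is what the primal movement has left after the
    descent lemma.\<close>
  also have "\<dots> \<le> (1 / (2 * \<gamma>) - L / 2) * (norm (A - B))\<^sup>2 + b * \<mu> / 4 * (norm B)\<^sup>2 + b / (2 * L) * (norm D)\<^sup>2"
    by (intro add_right_mono mult_right_mono) (use gL gamma_pos in \<open>auto simp: field_simps\<close>)
  finally show ?thesis unfolding k_def by (simp add: algebra_simps)
qed

end

section \<open>From the one-step inequality to the contraction factor\<close>

lemma inner_diff_polarization:
  fixes x y :: "'a::real_inner"
  shows "(x - y) \<bullet> y = ((norm x)\<^sup>2 - (norm y)\<^sup>2 - (norm (x - y))\<^sup>2) / 2"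
  by (simp add: power2_norm_eq_inner inner_diff inner_commute)

text \<open>\<open>Z\<close>, \<open>W\<close>, \<open>KW\<close> stand for squared norms and
  \<open>G\<close> for the gap at the old iterate. The primal and gap terms are compared separately,
  through the first and fourth ratio. The two dual terms have opposite signs, so they are compared
  jointly, as a weight times a remainder.\<close>

lemma energy_weights_contract:
  fixes a b :: real
  assumes pos: "\<gamma> > 0" "\<tau> > 0" "L > 0" "\<mu> \<ge> 0" "l > 0" "a > 0" "b \<ge> 1"
    and nonneg: "0 \<le> G" "0 \<le> Z" "0 \<le> W" and KW: "KW \<le> k * W"
    and stepsize: "\<gamma> * \<tau> * k \<le> 1 + a * \<gamma> * \<mu>" and "0 \<le> KW"
    and growth: "1 + b*\<gamma>*\<mu> \<le> (1 + a*\<gamma>*\<mu>) * (1 + min (1/4) (1/(4*a*\<gamma>*L)) * \<gamma>*\<tau>*l)"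
    and \<rho>: "1 / (1 + 1/2*a*\<gamma>*\<mu>) \<le> \<rho>" "b\<^sup>2 / (a\<^sup>2 + 1/4*a\<^sup>2*\<gamma>*\<tau>*l) \<le> \<rho>"
      "b\<^sup>2 / (a\<^sup>2 + 1/(4*\<gamma>*L)*a*\<gamma>*\<tau>*l) \<le> \<rho>" "(b\<^sup>2 - b) / a\<^sup>2 \<le> \<rho>"
  shows "1 / (2*\<gamma>) * Z + b\<^sup>2 / (2*\<tau>) * W - b\<^sup>2*\<gamma> / (2 + 2*b*\<gamma>*\<mu>) * KW + (b\<^sup>2 - b) * G
    \<le> \<rho> * ((2 + a*\<gamma>*\<mu>) / (4*\<gamma>) * Z
      + (2*a\<^sup>2 + min (1/2) (1/(2*a*\<gamma>*L)) * \<gamma>*\<tau>*a\<^sup>2*l) / (4*\<tau>) * W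
      - a\<^sup>2*\<gamma> / (2 + 2*a*\<gamma>*\<mu>) * KW + a\<^sup>2 * G)"
proof -
  define m where "m = min (1/4) (1/(4*a*\<gamma>*L))"
  \<comment> \<open>Relative gain of the dual weight: the old weight of \<open>W\<close> is
    \<open>a\<^sup>2 * (1 + \<kappa>) / (2*\<tau>)\<close>.\<close>
  define \<kappa> where "\<kappa> = m * \<gamma>*\<tau>*l"
  define q where "q = 1 + a*\<gamma>*\<mu>"
  have m2: "min (1/2) (1/(2*a*\<gamma>*L)) = 2 * m" by (auto simp: m_def min_def)
  have \<kappa>: "\<kappa> > 0" using pos by (simp add: \<kappa>_def m_def)
  have q: "q > 0" using pos by (simp add: q_def add_pos_nonneg)
  have bq: "1 + b*\<gamma>*\<mu> > 0" using pos by (simp add: add_pos_nonneg)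
  have Z_le: "1 / (2*\<gamma>) * Z \<le> \<rho> * ((2 + a*\<gamma>*\<mu>) / (4*\<gamma>) * Z)"
  proof -
    have "1 + 1/2*a*\<gamma>*\<mu> > 0" using pos by (simp add: add_pos_nonneg)
    then have "1 \<le> \<rho> * (1 + 1/2*a*\<gamma>*\<mu>)" using \<rho>(1) by (simp add: pos_divide_le_eq)
    then have "1 * (1 / (2*\<gamma>) * Z) \<le> \<rho> * (1 + 1/2*a*\<gamma>*\<mu>) * (1 / (2*\<gamma>) * Z)"
      by (rule mult_right_mono) (use pos nonneg in simp)
    then show ?thesis by (simp add: field_simps)
  qed
  have G_le: "(b\<^sup>2 - b) * G \<le> \<rho> * (a\<^sup>2 * G)"
  proof -
    have "b\<^sup>2 - b \<le> \<rho> * a\<^sup>2" using \<rho>(4) pos by (simp add: pos_divide_le_eq)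
    from mult_right_mono[OF this nonneg(1)] show ?thesis by (simp add: mult.assoc)
  qed
  \<comment> \<open>The branches of the minimum in \<open>\<kappa>\<close> correspond to the second
    and third ratio.\<close>
  have b2: "b\<^sup>2 \<le> \<rho> * (a\<^sup>2 * (1 + \<kappa>))"
  proof (cases "1/4 \<le> 1/(4*a*\<gamma>*L)")
    case True
    then have "a\<^sup>2 * (1 + \<kappa>) = a\<^sup>2 + 1/4*a\<^sup>2*\<gamma>*\<tau>*l"
      by (simp add: \<kappa>_def m_def algebra_simps)
    moreover have "a\<^sup>2 * (1 + \<kappa>) > 0" using pos \<kappa> by simp
    ultimately show ?thesis using \<rho>(2) by (simp add: pos_divide_le_eq)
  next
    case False
    then have "m = 1/(4*a*\<gamma>*L)" by (simp add: m_def)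
    then have "a\<^sup>2 * (1 + \<kappa>) = a\<^sup>2 + 1/(4*\<gamma>*L)*a*\<gamma>*\<tau>*l"
      using pos by (simp add: \<kappa>_def power2_eq_square field_simps)
    moreover have "a\<^sup>2 * (1 + \<kappa>) > 0" using pos \<kappa> by simp
    ultimately show ?thesis using \<rho>(3) by (simp add: pos_divide_le_eq)
  qed
  \<comment> \<open>\<open>R\<close> is the old dual part divided by its weight. The step size
    condition makes it nonnegative, so its weight may be enlarged, and \<open>growth\<close> makes
    it dominate the new remainder.\<close>
  define R where "R = W - \<gamma> * \<tau> / (q * (1 + \<kappa>)) * KW"
  have R: "R \<ge> 0"
  proof -
    have "\<gamma> * \<tau> * KW \<le> \<gamma> * \<tau> * (k * W)" using KW pos by simp
    also have "\<dots> \<le> q * W" using mult_right_mono[OF stepsize nonneg(3)] by (simp add: q_def ac_simps)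
    also have "\<dots> \<le> q * (1 + \<kappa>) * W" using q \<kappa> nonneg by (simp add: mult_right_mono)
    finally have "\<gamma> * \<tau> * KW \<le> W * (q * (1 + \<kappa>))" by (simp add: ac_simps)
    moreover have "0 < q * (1 + \<kappa>)" using q \<kappa> by simp
    ultimately show ?thesis by (simp add: R_def pos_divide_le_eq del: distrib_left distrib_right)
  qed
  have "b\<^sup>2 / (2*\<tau>) * W - b\<^sup>2*\<gamma> / (2 + 2*b*\<gamma>*\<mu>) * KW
      = b\<^sup>2 / (2*\<tau>) * (W - \<gamma> * \<tau> / (1 + b*\<gamma>*\<mu>) * KW)"
  proof -
    have "b\<^sup>2*\<gamma> / (2 + 2*b*\<gamma>*\<mu>) = b\<^sup>2 / (2*\<tau>) * (\<gamma> * \<tau> / (1 + b*\<gamma>*\<mu>))"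
    proof -
      have "2 + 2*b*\<gamma>*\<mu> = 2 * (1 + b*\<gamma>*\<mu>)" by simp
      then show ?thesis using pos bq by (simp only:) (simp add: divide_simps)
    qed
    then show ?thesis by (simp add: right_diff_distrib)
  qed
  also have "\<dots> \<le> b\<^sup>2 / (2*\<tau>) * R"
  proof (rule mult_left_mono)
    have "\<gamma> * \<tau> / (q * (1 + \<kappa>)) \<le> \<gamma> * \<tau> / (1 + b*\<gamma>*\<mu>)"
      by (rule divide_left_mono) (use growth pos bq q \<kappa> in \<open>auto simp: q_def \<kappa>_def m_def\<close>)
    from mult_right_mono[OF this \<open>0 \<le> KW\<close>] show "W - \<gamma> * \<tau> / (1 + b*\<gamma>*\<mu>) * KW \<le> R"
      unfolding R_def by simp
  qed (use pos in simp)
  also have "\<dots> \<le> \<rho> * (a\<^sup>2 * (1 + \<kappa>)) / (2*\<tau>) * R"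
    by (intro mult_right_mono divide_right_mono b2 R) (use pos in simp)
  also have "\<dots> = \<rho> * ((2*a\<^sup>2 + 2 * m * \<gamma>*\<tau>*a\<^sup>2*l) / (4*\<tau>) * W - a\<^sup>2*\<gamma> / (2 + 2*a*\<gamma>*\<mu>) * KW)"
  proof -
    have "(2*a\<^sup>2 + 2 * m * \<gamma>*\<tau>*a\<^sup>2*l) / (4*\<tau>) = a\<^sup>2 * (1 + \<kappa>) / (2*\<tau>)"
      by (simp add: \<kappa>_def algebra_simps add_divide_distrib)
    moreover have "a\<^sup>2*\<gamma> / (2 + 2*a*\<gamma>*\<mu>) = a\<^sup>2 * (1 + \<kappa>) / (2*\<tau>) * (\<gamma> * \<tau> / (q * (1 + \<kappa>)))"
    proof -
      have "2 + 2*a*\<gamma>*\<mu> = 2 * q" by (simp add: q_def)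
      then show ?thesis using pos q \<kappa> by (simp add: divide_simps)
    qed
    ultimately show ?thesis by (simp only: R_def) (simp only: right_diff_distrib mult.assoc times_divide_eq_right times_divide_eq_left)
  qed
  finally have "b\<^sup>2 / (2*\<tau>) * W - b\<^sup>2*\<gamma> / (2 + 2*b*\<gamma>*\<mu>) * KW \<le> \<dots>" .
  with Z_le G_le show ?thesis unfolding m2 by (simp add: distrib_left right_diff_distrib)
qed

context saddle_point_setting
begin

text \<open>The left side of the inequality is the new energy. The right side has weight
  \<open>b\<close> throughout and lacks the gains from \<open>\<mu>\<close> and
  \<open>lambda_min K\<close> in the distance weights; relating it to the old energy is left to
  \<open>energy_weights_contract\<close>.\<close>

lemma apapc_step:
  assumes b: "b \<ge> 1" and \<tau>: "\<tau> > 0" and stepsize: "\<gamma>*\<tau>*(onorm K)\<^sup>2 \<le> 1 + b*\<gamma>*\<mu>"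
    and u: "conjugate h u < \<infinity>"
    and y: "y = (1 - 1/b) *\<^sub>R x + (1/b) *\<^sub>R z"
    and zh: "zh = inverse (1 + b*\<gamma>*\<mu>) *\<^sub>R (z - (b*\<gamma>) *\<^sub>R f' y - (b*\<gamma>) *\<^sub>R adjoint K v)"
    and v': "v' = prox (\<lambda>w. ereal (\<tau>/b) * conjugate h w) (v + (\<tau>/b) *\<^sub>R K zh)"
    and z': "z' = inverse (1 + b*\<gamma>*\<mu>) *\<^sub>R (z - (b*\<gamma>) *\<^sub>R f' y - (b*\<gamma>) *\<^sub>R adjoint K v')"
    and x': "x' = (1 - 1/b) *\<^sub>R x + (1/b) *\<^sub>R z'"
    and u': "u' = (1 - 1/b) *\<^sub>R u + (1/b) *\<^sub>R v'"
  shows "conjugate h u' < \<infinity>"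
    and "(2 + b*\<gamma>*\<mu>) / (4*\<gamma>) * (norm (z' - xs))\<^sup>2
      + (2*b\<^sup>2 + min (1/2) (1/(2*b*\<gamma>*L)) * \<gamma>*\<tau>*b\<^sup>2*lambda_min K) / (4*\<tau>) * (norm (v' - us))\<^sup>2
      - b\<^sup>2*\<gamma> / (2 + 2*b*\<gamma>*\<mu>) * (norm (adjoint K (v' - us)))\<^sup>2
      + b\<^sup>2 * gap x' u'
    \<le> 1 / (2*\<gamma>) * (norm (z - xs))\<^sup>2 + b\<^sup>2 / (2*\<tau>) * (norm (v - us))\<^sup>2
      - b\<^sup>2*\<gamma> / (2 + 2*b*\<gamma>*\<mu>) * (norm (adjoint K (v - us)))\<^sup>2 + (b\<^sup>2 - b) * gap x u"
proof -
  define A B D where "A = z - xs" and "B = z' - xs" and "D = f' y - f' xs"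
  define w w' where "w = v - us" and "w' = v' - us"
  define Kw Kw' where "Kw = adjoint K w" and "Kw' = adjoint K w'"
  define q where "q = 1 + b*\<gamma>*\<mu>"
  define c where "c = b\<^sup>2*\<gamma> / q"
  define p where "p = (1 / (\<tau>/b)) *\<^sub>R (v + (\<tau>/b) *\<^sub>R K zh - v')"
  have q: "q > 0" using b gamma_pos mu_nonneg by (simp add: q_def add_pos_nonneg)
  have c2: "b\<^sup>2*\<gamma> / (2 + 2*b*\<gamma>*\<mu>) = c / 2"
  proof -
    have "2 + 2*b*\<gamma>*\<mu> = 2 * q" by (simp add: q_def)
    then show ?thesis by (simp add: c_def)
  qed
  have p: "p \<in> subdifferential (conjugate h) v'"
    unfolding p_def by (rule prox_conjugate_subdifferential[OF h_proper u _ v']) (use \<tau> b in simp)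
  show "conjugate h u' < \<infinity>" by (rule breg_h_step(1)[OF b u p u'])
  \<comment> \<open>The update is implicit in the quadratic: multiplying by \<open>q\<close> moves
    the \<open>\<mu>\<close> term to \<open>z'\<close>. With the optimality condition at
    \<open>xs\<close> only differences remain.\<close>
  have rel: "A - B = (b * \<gamma>) *\<^sub>R (D + \<mu> *\<^sub>R B + Kw')"
  proof -
    have "q *\<^sub>R z' = z - (b*\<gamma>) *\<^sub>R f' y - (b*\<gamma>) *\<^sub>R adjoint K v'"
      using q by (simp add: z' q_def)
    then have "z = z' + (b*\<gamma>*\<mu>) *\<^sub>R z' + (b*\<gamma>) *\<^sub>R f' y + (b*\<gamma>) *\<^sub>R adjoint K v'"
      by (simp add: q_def algebra_simps)
    then show ?thesis
      by (simp add: A_def B_def D_def Kw'_def w'_def adjoint_diff[OF K_linear] gradient_xs algebra_simps)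
  qed
  \<comment> \<open>Predictor and corrector differ only by the dual increment; this mismatch
    produces the seminorm terms with coefficient \<open>c\<close>.\<close>
  have zh_z': "zh - z' = (b*\<gamma>/q) *\<^sub>R (Kw' - Kw)"
    by (simp add: zh z' Kw_def Kw'_def w_def w'_def q_def adjoint_diff[OF K_linear]
      divide_inverse scaleR_diff_right ac_simps)
  have "(p - K xs) \<bullet> w' = (b/\<tau>) * ((w - w') \<bullet> w') + (zh - xs) \<bullet> Kw'"
  proof -
    have "p = (b/\<tau>) *\<^sub>R (w - w') + K zh"
      using \<tau> b by (simp add: p_def w_def w'_def algebra_simps)
    then have "p - K xs = (b/\<tau>) *\<^sub>R (w - w') + K (zh - xs)"
      using K_linear by (simp add: linear_diff bounded_linear.linear)
    then show ?thesis by (simp add: inner_add_left adjoint_inner[OF K_linear] Kw'_def)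
  qed
  also have "(zh - xs) \<bullet> Kw' = B \<bullet> Kw' + (b*\<gamma>/q) * ((Kw' - Kw) \<bullet> Kw')"
  proof -
    have "zh - xs = B + (zh - z')" by (simp add: B_def)
    then show ?thesis by (simp add: zh_z' inner_add_left)
  qed
  also have "(Kw' - Kw) \<bullet> Kw' = - ((Kw - Kw') \<bullet> Kw')" by (simp add: inner_diff_left)
  finally have pKxs: "(p - K xs) \<bullet> w'
      = (b/\<tau>) * ((w - w') \<bullet> w') + (B \<bullet> Kw' + (b*\<gamma>/q) * - ((Kw - Kw') \<bullet> Kw'))" .
  have "b * ((b/\<tau>) * X + (Y + (b*\<gamma>/q) * - Z)) = b\<^sup>2/\<tau> * X + b * Y - c * Z" for X Y Z
    by (simp add: c_def power2_eq_square algebra_simps)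
  then have dual: "b * ((p - K xs) \<bullet> w')
      = b\<^sup>2/\<tau> * ((w - w') \<bullet> w') + b * (B \<bullet> Kw') - c * ((Kw - Kw') \<bullet> Kw')"
    unfolding pKxs .
  have "(A - B) \<bullet> B = b * \<gamma> * (B \<bullet> D + \<mu> * (norm B)\<^sup>2 + B \<bullet> Kw')"
    unfolding rel by (simp add: inner_add_right power2_norm_eq_inner inner_commute)
  then have primal: "b * (B \<bullet> D) + b * \<mu> * (norm B)\<^sup>2 + b * (B \<bullet> Kw') = 1/\<gamma> * ((A - B) \<bullet> B)"
    using gamma_pos by (simp add: field_simps)
  have "b\<^sup>2 * gap x' u' \<le> (b\<^sup>2 - b) * gap x u + b * (B \<bullet> D) + b * (\<mu> / 2 * (norm B)\<^sup>2)
      + b * ((p - K xs) \<bullet> w') + L / 2 * (norm (A - B))\<^sup>2 - b / (2 * L) * (norm D)\<^sup>2"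
  proof -
    have "norm (z' - z) = norm (A - B)" by (simp add: A_def B_def norm_minus_commute)
    then show ?thesis
      using breg_f_step[OF b y x'] breg_h_step(2)[OF b u p u'] quadratic_step[OF b x', folded B_def]
      unfolding gap_def D_def[symmetric] B_def[symmetric] w'_def[symmetric]
      by (simp add: distrib_left)
  qed
  \<comment> \<open>Of the remaining \<open>b * \<mu> / 2\<close>, one half enters the primal weight
    of the new energy and the other half is spent on \<open>residual\<close>.\<close>
  then have descent: "b\<^sup>2 * gap x' u' \<le> (b\<^sup>2 - b) * gap x u + 1/\<gamma> * ((A - B) \<bullet> B) - b * \<mu> / 2 * (norm B)\<^sup>2
      + b\<^sup>2/\<tau> * ((w - w') \<bullet> w') - c * ((Kw - Kw') \<bullet> Kw')
      + L / 2 * (norm (A - B))\<^sup>2 - b / (2 * L) * (norm D)\<^sup>2"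
    using primal dual by (simp add: algebra_simps)
  have residual: "min (1/2) (1 / (2 * b * \<gamma> * L)) * \<gamma> * b\<^sup>2 * lambda_min K / 4 * (norm w')\<^sup>2
    \<le> b * \<mu> / 4 * (norm B)\<^sup>2 + (1 / (2 * \<gamma>) - L / 2) * (norm (A - B))\<^sup>2 + b / (2 * L) * (norm D)\<^sup>2"
    by (rule dual_residual_bound[OF _ rel[unfolded Kw'_def]]) (use b in simp)
  \<comment> \<open>Polarisation leaves \<open>c / 2 * (norm (Kw - Kw'))\<^sup>2\<close> with the
    wrong sign; the step size condition lets the dual movement absorb it.\<close>
  have step_nonneg: "c / 2 * (norm (Kw - Kw'))\<^sup>2 \<le> b\<^sup>2 / (2*\<tau>) * (norm (w - w'))\<^sup>2"
  proof -
    have "(norm (Kw - Kw'))\<^sup>2 \<le> (onorm K * norm (w - w'))\<^sup>2"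
      unfolding Kw_def Kw'_def adjoint_diff[OF K_linear, symmetric]
      by (intro power_mono norm_adjoint_le K_linear) simp
    then have "c / 2 * (norm (Kw - Kw'))\<^sup>2 \<le> c / 2 * ((onorm K)\<^sup>2 * (norm (w - w'))\<^sup>2)"
      using q gamma_pos by (intro mult_left_mono) (auto simp: c_def power_mult_distrib)
    also have "\<dots> = \<gamma>*\<tau>*(onorm K)\<^sup>2 / q * (b\<^sup>2 / (2*\<tau>) * (norm (w - w'))\<^sup>2)"
      using \<tau> by (simp add: c_def field_simps)
    also have "\<dots> \<le> 1 * (b\<^sup>2 / (2*\<tau>) * (norm (w - w'))\<^sup>2)"
      by (rule mult_right_mono) (use stepsize q \<tau> in \<open>auto simp: q_def pos_divide_le_eq\<close>)
    finally show ?thesis by simp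
  qed
  have coeff: "(2 + b*\<gamma>*\<mu>) / (4*\<gamma>) = 1 / (2*\<gamma>) + b*\<mu>/4"
    "(2*b\<^sup>2 + k * \<gamma>*\<tau>*b\<^sup>2*l) / (4*\<tau>) = b\<^sup>2 / (2*\<tau>) + k * \<gamma> * b\<^sup>2 * l / 4" for k l
    using gamma_pos \<tau> by (simp_all add: field_simps)
  show "(2 + b*\<gamma>*\<mu>) / (4*\<gamma>) * (norm (z' - xs))\<^sup>2
      + (2*b\<^sup>2 + min (1/2) (1/(2*b*\<gamma>*L)) * \<gamma>*\<tau>*b\<^sup>2*lambda_min K) / (4*\<tau>) * (norm (v' - us))\<^sup>2
      - b\<^sup>2*\<gamma> / (2 + 2*b*\<gamma>*\<mu>) * (norm (adjoint K (v' - us)))\<^sup>2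
      + b\<^sup>2 * gap x' u'
    \<le> 1 / (2*\<gamma>) * (norm (z - xs))\<^sup>2 + b\<^sup>2 / (2*\<tau>) * (norm (v - us))\<^sup>2
      - b\<^sup>2*\<gamma> / (2 + 2*b*\<gamma>*\<mu>) * (norm (adjoint K (v - us)))\<^sup>2 + (b\<^sup>2 - b) * gap x u"
    unfolding c2 coeff A_def[symmetric] B_def[symmetric] w_def[symmetric] w'_def[symmetric]
      Kw_def[symmetric] Kw'_def[symmetric]
    using descent residual step_nonneg
    unfolding inner_diff_polarization
    by (simp add: algebra_simps diff_divide_distrib add_divide_distrib)
qed

lemma energy_finite:
  assumes "conjugate h u < \<infinity>"
  shows "energy f h K L \<mu> \<gamma> \<tau> b xs us x z u v =
    ereal ((2 + b*\<gamma>*\<mu>) / (4*\<gamma>) * (norm (z - xs))\<^sup>2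
      + (2*b\<^sup>2 + min (1/2) (1/(2*b*\<gamma>*L)) * \<gamma>*\<tau>*b\<^sup>2*lambda_min K) / (4*\<tau>) * (norm (v - us))\<^sup>2
      - b\<^sup>2*\<gamma> / (2 + 2*b*\<gamma>*\<mu>) * (norm (adjoint K (v - us)))\<^sup>2 + b\<^sup>2 * gap x u)"
  unfolding energy_def lagrangian_gap_finite[OF assms] by simp

lemma energy_infinite:
  assumes "\<not> conjugate h u < \<infinity>" and "b > 0"
  shows "energy f h K L \<mu> \<gamma> \<tau> b xs us x z u v = \<infinity>"
  unfolding energy_def lagrangian_gap_infinite[OF assms(1)] using assms(2) by simp

lemma energy_contraction:
  assumes a: "a > 0" and b: "b \<ge> 1" and \<tau>: "\<tau> > 0"
    and stepsize: "\<gamma>*\<tau>*(onorm K)\<^sup>2 \<le> 1 + a*\<gamma>*\<mu>" and ab: "a \<le> b"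
    and growth: "1 + b*\<gamma>*\<mu> \<le> (1 + a*\<gamma>*\<mu>) * (1 + min (1/4) (1/(4*a*\<gamma>*L)) * \<gamma>*\<tau>*lambda_min K)"
    and y: "y = (1 - 1/b) *\<^sub>R x + (1/b) *\<^sub>R z"
    and zh: "zh = inverse (1 + b*\<gamma>*\<mu>) *\<^sub>R (z - (b*\<gamma>) *\<^sub>R f' y - (b*\<gamma>) *\<^sub>R adjoint K v)"
    and v': "v' = prox (\<lambda>w. ereal (\<tau>/b) * conjugate h w) (v + (\<tau>/b) *\<^sub>R K zh)"
    and z': "z' = inverse (1 + b*\<gamma>*\<mu>) *\<^sub>R (z - (b*\<gamma>) *\<^sub>R f' y - (b*\<gamma>) *\<^sub>R adjoint K v')"
    and x': "x' = (1 - 1/b) *\<^sub>R x + (1/b) *\<^sub>R z'"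
    and u': "u' = (1 - 1/b) *\<^sub>R u + (1/b) *\<^sub>R v'"
    and \<rho>: "1 / (1 + 1/2*a*\<gamma>*\<mu>) \<le> \<rho>" "b\<^sup>2 / (a\<^sup>2 + 1/4*a\<^sup>2*\<gamma>*\<tau>*lambda_min K) \<le> \<rho>"
      "b\<^sup>2 / (a\<^sup>2 + 1/(4*\<gamma>*L)*a*\<gamma>*\<tau>*lambda_min K) \<le> \<rho>" "(b\<^sup>2 - b) / a\<^sup>2 \<le> \<rho>"
  shows "energy f h K L \<mu> \<gamma> \<tau> b xs us x' z' u' v' \<le> ereal \<rho> * energy f h K L \<mu> \<gamma> \<tau> a xs us x z u v"
proof (cases "conjugate h u < \<infinity>")
  case True
  have "a * (\<gamma> * \<mu>) \<le> b * (\<gamma> * \<mu>)"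
    using ab gamma_pos mu_nonneg by (intro mult_right_mono) auto
  then have stepsize': "\<gamma>*\<tau>*(onorm K)\<^sup>2 \<le> 1 + b*\<gamma>*\<mu>"
    using stepsize by (simp add: mult.assoc)
  note step = apapc_step[OF b \<tau> stepsize' True y zh v' z' x' u']
  have "(norm (adjoint K (v - us)))\<^sup>2 \<le> (onorm K * norm (v - us))\<^sup>2"
    by (intro power_mono norm_adjoint_le K_linear) simp
  then have Kv: "(norm (adjoint K (v - us)))\<^sup>2 \<le> (onorm K)\<^sup>2 * (norm (v - us))\<^sup>2"
    by (simp add: power_mult_distrib)
  show ?thesis
    unfolding energy_finite[OF True] energy_finite[OF step(1)] times_ereal.simps ereal_less_eq
    by (rule order_trans[OF step(2)])
      (rule energy_weights_contract[OF gamma_pos \<tau> L_pos mu_nonneg lambda_pos a b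
        gap_nonneg[OF True] zero_le_power2 zero_le_power2 Kv stepsize zero_le_power2 growth \<rho>])
next
  case False
  \<comment> \<open>The old energy is infinite here, and a positive \<open>\<rho>\<close> keeps the
    right side infinite.\<close>
  have "0 < 1 / (1 + 1/2*a*\<gamma>*\<mu>)" using a gamma_pos mu_nonneg by (simp add: add_pos_nonneg)
  then have "\<rho> > 0" using \<rho>(1) by linarith
  then show ?thesis unfolding energy_infinite[OF False a] by simp
qed

end

section \<open>Accelerated rates\<close>

text \<open>Each member of the minimum yields one of the three quadratic bounds; the last member is
  the larger root of \<open>s\<^sup>2 - s = (a t)\<^sup>2\<close>. The recursion starts at index 1,
  so index 0 rests on \<open>init\<close>.\<close>

lemma accelerated_weights:
  fixes a :: "nat \<Rightarrow> real"
  assumes pos: "r > 0" "q > 0" and init: "a 0 = 1" "a 1 = 1"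
    and rec: "\<And>t. t \<ge> 1 \<Longrightarrow> a (Suc t) = min (a t * sqrt (1 + r))
      (min (sqrt ((a t)\<^sup>2 + a t * q)) ((1 + sqrt (1 + 4 * (a t)\<^sup>2)) / 2))"
  shows "a t \<ge> 1" and "a t \<le> a (Suc t)"
    and "(a (Suc t))\<^sup>2 \<le> (a t)\<^sup>2 * (1 + r)"
    and "(a (Suc t))\<^sup>2 \<le> (a t)\<^sup>2 + a t * q"
    and "(a (Suc t))\<^sup>2 - a (Suc t) \<le> (a t)\<^sup>2"
    and "\<exists>\<delta>>0. \<forall>t. \<delta> * real t \<le> a t"
proof -
  \<comment> \<open>Since \<open>\<delta> \<le> 1 \<le> a t\<close>,
    \<open>(a t + \<delta>)\<^sup>2\<close> exceeds \<open>(a t)\<^sup>2\<close> by at most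
    \<open>3 * \<delta> * a t\<close>, whence the thirds; 1/2 comes from the last member of the
    minimum, which is at least \<open>a t + 1/2\<close>.\<close>
  define \<delta> where "\<delta> = min (1/2) (min (r/3) (q/3))"
  have \<delta>: "0 < \<delta>" "\<delta> \<le> 1/2" "3 * \<delta> \<le> r" "3 * \<delta> \<le> q"
    using pos by (auto simp: \<delta>_def min_def)
  have step: "a t + \<delta> \<le> a (Suc t)" if "t \<ge> 1" "a t \<ge> 1" for t
  proof -
    have "\<delta>\<^sup>2 \<le> \<delta> * 1" unfolding power2_eq_square using \<delta> by (intro mult_left_mono) auto
    also have "\<dots> \<le> \<delta> * a t" using \<delta> that by (intro mult_left_mono) auto
    finally have sq: "(a t + \<delta>)\<^sup>2 \<le> (a t)\<^sup>2 + 3 * \<delta> * a t"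
      by (simp add: power2_sum)
    also have "\<dots> \<le> (a t)\<^sup>2 + q * a t" using \<delta> that by (intro add_left_mono mult_right_mono) auto
    finally have 2: "a t + \<delta> \<le> sqrt ((a t)\<^sup>2 + a t * q)"
      by (intro real_le_rsqrt) (simp add: mult.commute)
    have "3 * \<delta> * a t \<le> r * (a t)\<^sup>2"
      unfolding power2_eq_square mult.assoc[symmetric]
      using mult_mono[of "3 * \<delta>" r 1 "a t"] \<delta> that by (intro mult_right_mono) auto
    with sq have "a t + \<delta> \<le> sqrt ((a t)\<^sup>2 * (1 + r))"
      by (intro real_le_rsqrt) (simp add: algebra_simps)
    then have 1: "a t + \<delta> \<le> a t * sqrt (1 + r)" using that by (simp add: real_sqrt_mult)
    have "2 * a t \<le> sqrt (1 + 4 * (a t)\<^sup>2)" by (rule real_le_rsqrt) (simp add: power_mult_distrib)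
    then have 3: "a t + \<delta> \<le> (1 + sqrt (1 + 4 * (a t)\<^sup>2)) / 2" using \<delta> by simp
    show ?thesis unfolding rec[OF that(1)] using 1 2 3 by simp
  qed
  have lower: "a t \<ge> 1 \<and> \<delta> * real t \<le> a t" for t
  proof (induction t)
    case (Suc t)
    show ?case
    proof (cases "t = 0")
      case False
      then show ?thesis using step[of t] Suc \<delta> by (simp add: distrib_left)
    qed (use init \<delta> in simp)
  qed (use init in simp)
  show a: "a t \<ge> 1" for t using lower by blast
  show "\<exists>\<delta>>0. \<forall>t. \<delta> * real t \<le> a t" using lower \<delta> by blast
  have t0: "a (Suc t) = 1" "a t = 1" if "\<not> t \<ge> 1"
    using that init by (auto simp: not_le)
  show "a t \<le> a (Suc t)"
    using step[of t] a[of t] \<delta> t0 by (cases "t \<ge> 1") auto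
  show "(a (Suc t))\<^sup>2 \<le> (a t)\<^sup>2 * (1 + r)"
  proof (cases "t \<ge> 1")
    case True
    then have "a (Suc t) \<le> a t * sqrt (1 + r)" using rec by simp
    then have "(a (Suc t))\<^sup>2 \<le> (a t * sqrt (1 + r))\<^sup>2"
      using a[of "Suc t"] by (intro power_mono) auto
    then show ?thesis using pos by (simp add: power_mult_distrib)
  qed (use t0 pos in simp)
  show "(a (Suc t))\<^sup>2 \<le> (a t)\<^sup>2 + a t * q"
  proof (cases "t \<ge> 1")
    case True
    then have "a (Suc t) \<le> sqrt ((a t)\<^sup>2 + a t * q)" using rec by simp
    then have "(a (Suc t))\<^sup>2 \<le> (sqrt ((a t)\<^sup>2 + a t * q))\<^sup>2"
      using a[of "Suc t"] by (intro power_mono) auto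
    then show ?thesis using pos a[of t] by simp
  qed (use t0 pos in simp)
  show "(a (Suc t))\<^sup>2 - a (Suc t) \<le> (a t)\<^sup>2"
  proof (cases "t \<ge> 1")
    case True
    have "a (Suc t) \<le> (1 + sqrt (1 + 4 * (a t)\<^sup>2)) / 2"
      unfolding rec[OF True] by (rule min.coboundedI2, rule min.cobounded2)
    then have "2 * a (Suc t) - 1 \<le> sqrt (1 + 4 * (a t)\<^sup>2)" by simp
    then have "(2 * a (Suc t) - 1)\<^sup>2 \<le> (sqrt (1 + 4 * (a t)\<^sup>2))\<^sup>2"
      using a[of "Suc t"] by (intro power_mono) auto
    then show ?thesis by (simp add: power2_eq_square algebra_simps)
  qed (use t0 in simp)
qed

lemma bigo_cmult:
  fixes f g :: "'a \<Rightarrow> real"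
  assumes "f \<in> O[F](g)"
  shows "(\<lambda>x. c * f x) \<in> O[F](g)"
  using assms by (cases "c = 0") simp_all

section \<open>Lower bounds on the energy and its contraction along the iterates\<close>

context saddle_point_setting
begin

lemma lagrangian_gap_nonneg: "0 \<le> lagrangian_gap f h K \<mu> xs us x u"
  using lagrangian_gap_finite[of u x] lagrangian_gap_infinite[of u x] gap_nonneg[of u x]
  by (cases "conjugate h u < \<infinity>") auto

text \<open>The subtracted seminorm is bounded through \<open>onorm K\<close>, and its denominator
  is at least 2. What remains of the dual weight is a part that vanishes when
  \<open>\<gamma>*\<tau>*(onorm K)\<^sup>2 = 1\<close> and a part from \<open>lambda_min K\<close>;
  this split separates the two dual rates.\<close>

lemma energy_ge_dual_distance_plus_gap:
  assumes b: "b > 0" and \<tau>: "\<tau> > 0"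
  shows "ereal ((b\<^sup>2 / (2*\<tau>) * (1 - \<gamma>*\<tau>*(onorm K)\<^sup>2)
        + min (1/2) (1/(2*b*\<gamma>*L)) * \<gamma>*b\<^sup>2*lambda_min K / 4) * (norm (v - us))\<^sup>2)
      + ereal (b\<^sup>2) * lagrangian_gap f h K \<mu> xs us x u
    \<le> energy f h K L \<mu> \<gamma> \<tau> b xs us x z u v"
  unfolding energy_def
proof (intro add_right_mono, unfold ereal_less_eq)
  define k where "k = min (1/2) (1/(2*b*\<gamma>*L))"
  have "(norm (adjoint K (v - us)))\<^sup>2 \<le> (onorm K * norm (v - us))\<^sup>2"
    by (intro power_mono norm_adjoint_le K_linear) simp
  then have "b\<^sup>2*\<gamma> / (2 + 2*b*\<gamma>*\<mu>) * (norm (adjoint K (v - us)))\<^sup>2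
      \<le> b\<^sup>2*\<gamma> / 2 * ((onorm K)\<^sup>2 * (norm (v - us))\<^sup>2)"
    by (intro mult_mono divide_left_mono)
      (use b gamma_pos mu_nonneg in \<open>auto simp: power_mult_distrib add_pos_nonneg\<close>)
  moreover have "0 \<le> (2 + b*\<gamma>*\<mu>) / (4*\<gamma>) * (norm (z - xs))\<^sup>2"
    using b gamma_pos mu_nonneg by simp
  moreover have "(2*b\<^sup>2 + k * \<gamma>*\<tau>*b\<^sup>2*lambda_min K) / (4*\<tau>) - b\<^sup>2*\<gamma> / 2 * (onorm K)\<^sup>2
      = b\<^sup>2 / (2*\<tau>) * (1 - \<gamma>*\<tau>*(onorm K)\<^sup>2) + k * \<gamma>*b\<^sup>2*lambda_min K / 4"
    using \<tau> by (simp add: field_simps)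
  from this[symmetric] have "(b\<^sup>2 / (2*\<tau>) * (1 - \<gamma>*\<tau>*(onorm K)\<^sup>2) + k * \<gamma>*b\<^sup>2*lambda_min K / 4) * (norm (v - us))\<^sup>2
      = (2*b\<^sup>2 + k * \<gamma>*\<tau>*b\<^sup>2*lambda_min K) / (4*\<tau>) * (norm (v - us))\<^sup>2
        - b\<^sup>2*\<gamma> / 2 * ((onorm K)\<^sup>2 * (norm (v - us))\<^sup>2)"
    by (simp add: left_diff_distrib)
  ultimately show "(b\<^sup>2 / (2*\<tau>) * (1 - \<gamma>*\<tau>*(onorm K)\<^sup>2)
        + min (1/2) (1/(2*b*\<gamma>*L)) * \<gamma>*b\<^sup>2*lambda_min K / 4) * (norm (v - us))\<^sup>2
    \<le> (2 + b*\<gamma>*\<mu>) / (4*\<gamma>) * (norm (z - xs))\<^sup>2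
      + (2*b\<^sup>2 + min (1/2) (1/(2*b*\<gamma>*L)) * \<gamma>*\<tau>*b\<^sup>2*lambda_min K) / (4*\<tau>) * (norm (v - us))\<^sup>2
      - b\<^sup>2*\<gamma> / (2 + 2*b*\<gamma>*\<mu>) * (norm (adjoint K (v - us)))\<^sup>2"
    unfolding k_def by linarith
qed

lemma apapc_energy_contraction:
  assumes it: "apapc f' h K \<mu> \<gamma> \<tau> a x z u v" and \<tau>: "\<tau> > 0"
    and a: "a t > 0" "a (Suc t) \<ge> 1" "a t \<le> a (Suc t)"
    and stepsize: "\<gamma>*\<tau>*(onorm K)\<^sup>2 \<le> 1 + a t*\<gamma>*\<mu>"
    and growth: "1 + a (Suc t)*\<gamma>*\<mu>
      \<le> (1 + a t*\<gamma>*\<mu>) * (1 + min (1/4) (1/(4*a t*\<gamma>*L)) * \<gamma>*\<tau>*lambda_min K)"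
    and \<rho>: "1 / (1 + 1/2*a t*\<gamma>*\<mu>) \<le> \<rho>"
      "(a (Suc t))\<^sup>2 / ((a t)\<^sup>2 + 1/4*(a t)\<^sup>2*\<gamma>*\<tau>*lambda_min K) \<le> \<rho>"
      "(a (Suc t))\<^sup>2 / ((a t)\<^sup>2 + 1/(4*\<gamma>*L)*a t*\<gamma>*\<tau>*lambda_min K) \<le> \<rho>"
      "((a (Suc t))\<^sup>2 - a (Suc t)) / (a t)\<^sup>2 \<le> \<rho>"
  shows "energy f h K L \<mu> \<gamma> \<tau> (a (Suc t)) xs us (x (Suc t)) (z (Suc t)) (u (Suc t)) (v (Suc t))
    \<le> ereal \<rho> * energy f h K L \<mu> \<gamma> \<tau> (a t) xs us (x t) (z t) (u t) (v t)"
proof -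
  from it have
    "v (Suc t) = prox (\<lambda>w. ereal (\<tau> / a (Suc t)) * conjugate h w)
      (v t + (\<tau> / a (Suc t)) *\<^sub>R K (inverse (1 + a (Suc t)*\<gamma>*\<mu>) *\<^sub>R
        (z t - (a (Suc t)*\<gamma>) *\<^sub>R f' ((1 - 1 / a (Suc t)) *\<^sub>R x t + (1 / a (Suc t)) *\<^sub>R z t)
          - (a (Suc t)*\<gamma>) *\<^sub>R adjoint K (v t))))"
    "z (Suc t) = inverse (1 + a (Suc t)*\<gamma>*\<mu>) *\<^sub>R
      (z t - (a (Suc t)*\<gamma>) *\<^sub>R f' ((1 - 1 / a (Suc t)) *\<^sub>R x t + (1 / a (Suc t)) *\<^sub>R z t)
        - (a (Suc t)*\<gamma>) *\<^sub>R adjoint K (v (Suc t)))"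
    "x (Suc t) = (1 - 1 / a (Suc t)) *\<^sub>R x t + (1 / a (Suc t)) *\<^sub>R z (Suc t)"
    "u (Suc t) = (1 - 1 / a (Suc t)) *\<^sub>R u t + (1 / a (Suc t)) *\<^sub>R v (Suc t)"
    unfolding apapc_def Let_def by blast+
  then show ?thesis
    by (rule energy_contraction[OF a(1,2) \<tau> stepsize a(3) growth refl refl _ _ _ _ \<rho>])
qed

lemma onorm_pos: "onorm K > 0"
  using onorm_pos_lt[OF K_linear] K_nonzero by auto

section \<open>Rates for the accelerated step sizes\<close>

context
  fixes \<nu> \<tau> :: real and a :: "nat \<Rightarrow> real" and x z :: "nat \<Rightarrow> 'x" and u v :: "nat \<Rightarrow> 'u"
  assumes nu: "0 < \<nu>" "\<nu> \<le> 1" and tau: "\<tau> = \<nu> / (\<gamma>*(onorm K)\<^sup>2)"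
    and init: "a 0 = 1" "a 1 = 1"
    and rec: "\<And>t. t \<ge> 1 \<Longrightarrow> a (Suc t) =
      min (a t * sqrt (1 + \<nu>*lambda_min K / (4*(onorm K)\<^sup>2)))
        (min (sqrt ((a t)\<^sup>2 + a t * (\<nu>*lambda_min K / (4*\<gamma>*L*(onorm K)\<^sup>2))))
             ((1 + sqrt (1 + 4*(a t)\<^sup>2)) / 2))"
    and it: "apapc f' h K \<mu> \<gamma> \<tau> a x z u v"
begin

abbreviation "E t \<equiv> energy f h K L \<mu> \<gamma> \<tau> (a t) xs us (x t) (z t) (u t) (v t)"
abbreviation "G t \<equiv> lagrangian_gap f h K \<mu> xs us (x t) (u t)"

lemma tau_pos: "\<tau> > 0"
  using nu gamma_pos onorm_pos by (simp add: tau)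

lemma nu_eq: "\<gamma>*\<tau>*(onorm K)\<^sup>2 = \<nu>"
  using gamma_pos onorm_pos by (simp add: tau)

lemma weight_increments_pos:
  "\<nu>*lambda_min K / (4*(onorm K)\<^sup>2) > 0" "\<nu>*lambda_min K / (4*\<gamma>*L*(onorm K)\<^sup>2) > 0"
  using nu lambda_pos onorm_pos gamma_pos L_pos by simp_all

lemmas weights = accelerated_weights[where a=a, OF weight_increments_pos init rec]

text \<open>All four ratios are at most 1 for these weights, and the growth restriction of
  \<open>apapc_energy_contraction\<close> is derived from the recursion.\<close>

lemma energy_Suc_le: "E (Suc t) \<le> E t"
proof -
  define r q where "r = \<nu>*lambda_min K / (4*(onorm K)\<^sup>2)" and "q = \<nu>*lambda_min K / (4*\<gamma>*L*(onorm K)\<^sup>2)"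
  note w = weights[folded r_def q_def]
  have rq: "r > 0" "q > 0" using weight_increments_pos by (simp_all add: r_def q_def)
  have a: "a t \<ge> 1" "a (Suc t) \<ge> 1" "a t \<le> a (Suc t)" using w(1,2) by auto
  have r: "1/4*\<gamma>*\<tau>*lambda_min K = r" and q: "1/(4*\<gamma>*L)*\<gamma>*\<tau>*lambda_min K = q"
    using gamma_pos onorm_pos L_pos by (simp_all add: r_def q_def tau field_simps)
  have \<rho>2: "(a t)\<^sup>2 + 1/4*(a t)\<^sup>2*\<gamma>*\<tau>*lambda_min K = (a t)\<^sup>2 * (1 + r)"
    by (simp add: r[symmetric] algebra_simps)
  have \<rho>3: "(a t)\<^sup>2 + 1/(4*\<gamma>*L)*a t*\<gamma>*\<tau>*lambda_min K = (a t)\<^sup>2 + a t * q"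
    by (simp add: q[symmetric] algebra_simps)
  define \<kappa> where "\<kappa> = min (1/4) (1/(4*a t*\<gamma>*L)) * \<gamma>*\<tau>*lambda_min K"
  have \<kappa>_cases: "\<kappa> = r \<or> \<kappa> = q / a t"
    unfolding \<kappa>_def min_def by (simp add: r[symmetric] q[symmetric] mult.commute mult.left_commute)
  then have \<kappa>: "\<kappa> > 0" using rq a by auto
  have "(a (Suc t))\<^sup>2 \<le> (a t)\<^sup>2 * (1 + \<kappa>)"
    using \<kappa>_cases w(3,4)[of t] a by (auto simp: power2_eq_square field_simps)
  \<comment> \<open>Since \<open>1 + \<kappa> \<ge> 1\<close>, the bound on squares weakens to one
    on \<open>a (Suc t) / a t\<close> itself, which suffices for \<open>growth\<close>.\<close>
  also have "\<dots> \<le> (a t * (1 + \<kappa>))\<^sup>2"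
    using \<kappa> unfolding power_mult_distrib by (intro mult_left_mono) (auto simp: power2_eq_square)
  finally have "a (Suc t) \<le> a t * (1 + \<kappa>)"
    by (rule power2_le_imp_le) (use a \<kappa> in simp)
  then have "a (Suc t) * (\<gamma> * \<mu>) \<le> a t * (1 + \<kappa>) * (\<gamma> * \<mu>)"
    by (rule mult_right_mono) (use gamma_pos mu_nonneg in simp)
  then have growth: "1 + a (Suc t)*\<gamma>*\<mu> \<le> (1 + a t*\<gamma>*\<mu>) * (1 + \<kappa>)"
    using \<kappa> by (simp add: algebra_simps)
  have "0 \<le> a t * \<gamma> * \<mu>" using a gamma_pos mu_nonneg by simp
  then have "\<gamma>*\<tau>*(onorm K)\<^sup>2 \<le> 1 + a t*\<gamma>*\<mu>" and \<rho>1: "1 / (1 + 1/2*a t*\<gamma>*\<mu>) \<le> 1"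
    using nu nu_eq by simp_all
  moreover have "(a (Suc t))\<^sup>2 / ((a t)\<^sup>2 + 1/4*(a t)\<^sup>2*\<gamma>*\<tau>*lambda_min K) \<le> 1"
    "(a (Suc t))\<^sup>2 / ((a t)\<^sup>2 + 1/(4*\<gamma>*L)*a t*\<gamma>*\<tau>*lambda_min K) \<le> 1"
    "((a (Suc t))\<^sup>2 - a (Suc t)) / (a t)\<^sup>2 \<le> 1"
    unfolding \<rho>2 \<rho>3 using w(3-5)[of t] a rq by (simp_all add: divide_le_eq_1 add_pos_pos)
  ultimately have "E (Suc t) \<le> ereal 1 * E t"
    by (intro apapc_energy_contraction[OF it tau_pos _ a(2,3) _ growth[unfolded \<kappa>_def] \<rho>1])
      (use a(1) in auto)
  then show ?thesis by simp
qed

lemma energy_antimono: "s \<le> t \<Longrightarrow> E t \<le> E s"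
  by (rule lift_Suc_antimono_le[of E]) (rule energy_Suc_le)

lemma dual_distance_le_energy:
  "ereal (((a t)\<^sup>2 / (2*\<tau>) * (1 - \<nu>)
      + min (1/2) (1/(2*a t*\<gamma>*L)) * \<gamma>*(a t)\<^sup>2*lambda_min K / 4) * (norm (v t - us))\<^sup>2)
    + ereal ((a t)\<^sup>2) * G t \<le> E t"
  using energy_ge_dual_distance_plus_gap[of "a t" \<tau> "v t" "x t" "u t" "z t"] weights(1)[of t] tau_pos
  unfolding nu_eq by simp

lemma dual_weight_nonneg:
  "0 \<le> (a t)\<^sup>2 / (2*\<tau>) * (1 - \<nu>)" "0 \<le> min (1/2) (1/(2*a t*\<gamma>*L)) * \<gamma>*(a t)\<^sup>2*lambda_min K / 4"
  using weights(1)[of t] tau_pos nu gamma_pos L_pos lambda_pos by simp_all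

lemma gap_le_energy: "ereal ((a t)\<^sup>2) * G t \<le> E t"
proof -
  have "0 + ereal ((a t)\<^sup>2) * G t \<le> ereal (((a t)\<^sup>2 / (2*\<tau>) * (1 - \<nu>)
      + min (1/2) (1/(2*a t*\<gamma>*L)) * \<gamma>*(a t)\<^sup>2*lambda_min K / 4) * (norm (v t - us))\<^sup>2)
    + ereal ((a t)\<^sup>2) * G t"
    using dual_weight_nonneg[of t] by (intro add_right_mono) simp
  then show ?thesis using dual_distance_le_energy[of t] by simp
qed

lemma energy_nonneg: "0 \<le> E t"
proof -
  have "0 \<le> ereal ((a t)\<^sup>2) * G t" by (intro ereal_0_le_mult lagrangian_gap_nonneg) simp
  also have "\<dots> \<le> E t" by (rule gap_le_energy)
  finally show ?thesis .
qed

text \<open>The reference index \<open>s\<close> is free because the initial energy may be infinite: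
  \<open>s = 0\<close> gives the bound by \<open>E 0\<close>, and \<open>s = 1\<close> serves the
  rate.\<close>

lemma gap_le_energy_div:
  assumes "s \<le> t"
  shows "G t \<le> E s / ereal ((a t)\<^sup>2)"
proof -
  have "ereal ((a t)\<^sup>2) * G t \<le> E s"
    using gap_le_energy energy_antimono[OF assms] by (rule order_trans)
  moreover have "0 < (a t)\<^sup>2" using weights(1)[of t] by auto
  ultimately show ?thesis by (intro ereal_le_divide_pos[THEN iffD2]) simp_all
qed

text \<open>Since \<open>a 1 = 1\<close>, the first dual average \<open>u 1\<close> is the proximal point \<open>v 1\<close>, so the energy is
  finite from the first step on even if it is infinite at the starting point.\<close>

lemma energy_1_finite: "\<exists>e. E 1 = ereal e"
proof -
  note step = it[unfolded apapc_def Let_def, THEN conjunct2, THEN conjunct2, rule_format, of 0, unfolded One_nat_def[symmetric] init]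
  from step have "u 1 = v 1" by simp
  from step obtain w where "v 1 = prox (\<lambda>w. ereal \<tau> * conjugate h w) w" by auto
  \<comment> \<open>The conjugate may be infinite at \<open>u 0\<close>, so \<open>us\<close> serves
    as the point where it is finite.\<close>
  then have "(1 / \<tau>) *\<^sub>R (w - v 1) \<in> subdifferential (conjugate h) (v 1)"
    by (rule prox_conjugate_subdifferential[OF h_proper conj_us_finite tau_pos])
  then have "conjugate h (u 1) < \<infinity>" unfolding \<open>u 1 = v 1\<close> subdifferential_def by auto
  from energy_finite[OF this] show ?thesis by blast
qed

text \<open>The gap and both parts of the dual weight are nonnegative, so each part alone is
  controlled by the energy at index 1.\<close>

lemma dual_distance_bound:
  assumes e: "E 1 = ereal e" and t: "t \<ge> 1"
  shows "(a t)\<^sup>2 / (2*\<tau>) * (1 - \<nu>) * (norm (v t - us))\<^sup>2 \<le> e"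
    and "min (1/2) (1/(2*a t*\<gamma>*L)) * \<gamma>*(a t)\<^sup>2*lambda_min K / 4 * (norm (v t - us))\<^sup>2 \<le> e"
proof -
  let ?p = "(a t)\<^sup>2 / (2*\<tau>) * (1 - \<nu>)" 
  let ?q = "min (1/2) (1/(2*a t*\<gamma>*L)) * \<gamma>*(a t)\<^sup>2*lambda_min K / 4"
  have "ereal ((?p + ?q) * (norm (v t - us))\<^sup>2) + 0
      \<le> ereal ((?p + ?q) * (norm (v t - us))\<^sup>2) + ereal ((a t)\<^sup>2) * G t"
    using lagrangian_gap_nonneg[of "x t" "u t"] by (intro add_left_mono ereal_0_le_mult) auto
  also have "\<dots> \<le> E t" by (rule dual_distance_le_energy)
  also have "\<dots> \<le> ereal e" using energy_antimono[OF t] e by simp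
  finally have "?p * (norm (v t - us))\<^sup>2 + ?q * (norm (v t - us))\<^sup>2 \<le> e" by (simp add: distrib_right)
  moreover have "0 \<le> ?p * (norm (v t - us))\<^sup>2" "0 \<le> ?q * (norm (v t - us))\<^sup>2"
    by (rule mult_nonneg_nonneg[OF dual_weight_nonneg(1) zero_le_power2],
        rule mult_nonneg_nonneg[OF dual_weight_nonneg(2) zero_le_power2])
  ultimately show "?p * (norm (v t - us))\<^sup>2 \<le> e" "?q * (norm (v t - us))\<^sup>2 \<le> e" by linarith+
qed

text \<open>Omega absorbs constants, so linear growth with the slope \<open>\<delta>\<close>
  suffices; the factor \<open>m / 2\<close> is at most 1.\<close>

lemma weights_bigomega:
  "a \<in> \<Omega>(\<lambda>t. real t / 2 * min 1 (\<nu>*lambda_min K / (4*\<gamma>*L*(onorm K)\<^sup>2)))"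
proof -
  obtain \<delta> where \<delta>: "\<delta> > 0" "\<And>t. \<delta> * real t \<le> a t" using weights(6) by blast
  define m where "m = min 1 (\<nu>*lambda_min K / (4*\<gamma>*L*(onorm K)\<^sup>2))"
  have m: "0 < m" "m \<le> 1" using weight_increments_pos(2) by (auto simp: m_def)
  have "\<delta> * norm (real t / 2 * m) \<le> norm (a t)" for t
  proof -
    have "\<delta> * norm (real t / 2 * m) = \<delta> * real t * (m / 2)" using m by (simp add: abs_mult)
    also have "\<dots> \<le> \<delta> * real t * 1" using \<delta> m by (intro mult_left_mono) auto
    also have "\<dots> \<le> norm (a t)" using \<delta>(2)[of t] by simp
    finally show ?thesis .
  qed
  then show ?thesis unfolding m_def[symmetric]
    by (intro landau_omega.bigI[OF \<delta>(1)] always_eventually allI)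
qed

lemma inverse_square_weights_bigo: "(\<lambda>t. 1 / (a t)\<^sup>2) \<in> O(\<lambda>t. 1 / (real t)\<^sup>2)"
proof -
  obtain \<delta> where \<delta>: "\<delta> > 0" "\<And>t. \<delta> * real t \<le> a t" using weights(6) by blast
  show ?thesis
  proof (rule bigoI[where c="1 / \<delta>\<^sup>2"], rule eventually_mono[OF eventually_gt_at_top[of 0]])
    fix t :: nat assume "t > 0"
    then have "(\<delta> * real t)\<^sup>2 \<le> (a t)\<^sup>2" "0 < (\<delta> * real t)\<^sup>2" using \<delta> by (auto intro!: power_mono)
    then have "1 / (a t)\<^sup>2 \<le> 1 / (\<delta> * real t)\<^sup>2" using weights(1)[of t] by (intro divide_left_mono) auto
    then show "norm (1 / (a t)\<^sup>2) \<le> 1 / \<delta>\<^sup>2 * norm (1 / (real t)\<^sup>2)"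
      by (simp add: power_mult_distrib)
  qed
qed

text \<open>The gap is extended-valued, so the rate is spelled out as an eventual bound; measured
  from \<open>E 1\<close>, it also covers an infinite \<open>E 0\<close>.\<close>

lemma gap_rate: "\<exists>C::real. \<forall>\<^sub>F t in sequentially. \<bar>G t\<bar> \<le> ereal (C / (real t)\<^sup>2)"
proof -
  obtain e where e: "E 1 = ereal e" using energy_1_finite by blast
  have "(\<lambda>t. e * (1 / (a t)\<^sup>2)) \<in> O(\<lambda>t. 1 / (real t)\<^sup>2)"
    by (rule bigo_cmult[OF inverse_square_weights_bigo])
  then obtain C where "\<forall>\<^sub>F t in sequentially. norm (e * (1 / (a t)\<^sup>2)) \<le> C * norm (1 / (real t)\<^sup>2)"
    by (elim landau_o.bigE)
  then have "\<forall>\<^sub>F t in sequentially. \<bar>G t\<bar> \<le> ereal (C / (real t)\<^sup>2)"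
    using eventually_ge_at_top[of 1]
  proof eventually_elim
    case (elim t)
    have "\<bar>G t\<bar> = G t" using lagrangian_gap_nonneg by (rule abs_ereal_ge0)
    also have "\<dots> \<le> ereal (e / (a t)\<^sup>2)"
      using gap_le_energy_div[OF elim(2)] weights(1)[of t] unfolding e by simp
    also have "\<dots> \<le> ereal (C / (real t)\<^sup>2)"
      using order_trans[OF abs_ge_self elim(1)[unfolded real_norm_def]] by simp
    finally show ?case .
  qed
  then show ?thesis by blast
qed

lemma energy_div_rate:
  assumes "E 0 < \<infinity>"
  shows "(\<lambda>t. real_of_ereal (E 0 / ereal ((a t)\<^sup>2))) \<in> O(\<lambda>t. 1 / (real t)\<^sup>2)"
proof -
  obtain e where e: "E 0 = ereal e" using assms energy_nonneg[of 0] by (cases "E 0") auto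
  have "real_of_ereal (E 0 / ereal ((a t)\<^sup>2)) = e * (1 / (a t)\<^sup>2)" for t
    using weights(1)[of t] unfolding e by simp
  then show ?thesis using bigo_cmult[OF inverse_square_weights_bigo, of e] by simp
qed

text \<open>For \<open>\<nu> < 1\<close> the first part of the dual weight is a positive multiple of
  \<open>(a t)\<^sup>2\<close>.\<close>

lemma dual_rate_strict:
  assumes "\<nu> < 1"
  shows "(\<lambda>t. (norm (v t - us))\<^sup>2) \<in> O(\<lambda>t. 1 / (real t)\<^sup>2)"
proof -
  obtain e where e: "E 1 = ereal e" using energy_1_finite by blast
  have "(\<lambda>t. (norm (v t - us))\<^sup>2) \<in> O(\<lambda>t. 1 / (a t)\<^sup>2)"
  proof (rule bigoI[where c="2 * \<tau> * e / (1 - \<nu>)"], rule eventually_mono[OF eventually_ge_at_top[of 1]])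
    fix t :: nat assume "t \<ge> 1"
    from dual_distance_bound(1)[OF e this] show
      "norm ((norm (v t - us))\<^sup>2) \<le> 2 * \<tau> * e / (1 - \<nu>) * norm (1 / (a t)\<^sup>2)"
      using assms tau_pos weights(1)[of t] by (simp add: field_simps)
  qed
  then show ?thesis using inverse_square_weights_bigo by (rule landau_o.big_trans)
qed

text \<open>Only the \<open>lambda_min K\<close> part of the dual weight is used. Its minimum can
  decay like \<open>1 / a t\<close>, so against the factor \<open>(a t)\<^sup>2\<close> the weight
  still grows at least linearly in \<open>a t\<close>.\<close>

lemma dual_rate: "(\<lambda>t. (norm (v t - us))\<^sup>2) \<in> O(\<lambda>t. 1 / real t)"
proof -
  obtain e where e: "E 1 = ereal e" using energy_1_finite by blast
  obtain \<delta> where \<delta>: "\<delta> > 0" "\<And>t. \<delta> * real t \<le> a t" using weights(6) by blast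
  define m where "m = min (1/2) (1/(2*\<gamma>*L)) * \<gamma> * lambda_min K / 4"
  have m: "m > 0" using gamma_pos L_pos lambda_pos by (simp add: m_def)
  show ?thesis
  proof (rule bigoI[where c="e / (m * \<delta>)"], rule eventually_mono[OF eventually_ge_at_top[of 1]])
    fix t :: nat assume t: "t \<ge> 1"
    have a: "a t \<ge> 1" by (rule weights(1))
    have "min (1/2) (1/(2*\<gamma>*L)) \<le> a t * min (1/2) (1/(2*a t*\<gamma>*L))"
    proof -
      have "a t * min (1/2) (1/(2*a t*\<gamma>*L)) = min (a t / 2) (1/(2*\<gamma>*L))"
        using a by (simp add: min_mult_distrib_left)
      then show ?thesis using a by auto
    qed
    then have "min (1/2) (1/(2*\<gamma>*L)) * (\<gamma> * lambda_min K / 4 * a t)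
        \<le> a t * min (1/2) (1/(2*a t*\<gamma>*L)) * (\<gamma> * lambda_min K / 4 * a t)"
      by (rule mult_right_mono) (use a gamma_pos lambda_pos in simp)
    then have "m * a t \<le> min (1/2) (1/(2*a t*\<gamma>*L)) * \<gamma>*(a t)\<^sup>2*lambda_min K / 4"
      by (simp add: m_def power2_eq_square ac_simps)
    moreover have "m * (\<delta> * real t) \<le> m * a t" using m \<delta>(2) by simp
    ultimately have "m * (\<delta> * real t) * (norm (v t - us))\<^sup>2
        \<le> min (1/2) (1/(2*a t*\<gamma>*L)) * \<gamma>*(a t)\<^sup>2*lambda_min K / 4 * (norm (v t - us))\<^sup>2"
      by (intro mult_right_mono) auto
    also have "\<dots> \<le> e" by (rule dual_distance_bound(2)[OF e t])
    finally show "norm ((norm (v t - us))\<^sup>2) \<le> e / (m * \<delta>) * norm (1 / real t)"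
      using m \<delta>(1) t by (simp add: field_simps)
  qed
qed

end

end

text \<open>The first half assumes the growth restriction recorded with \<open>energy\<close>; in
  the second half it follows from the weight recursion, through
  \<open>energy_Suc_le\<close>.\<close>

theorem theorem3p8:
  fixes f :: "'x::{real_inner,complete_space} \<Rightarrow> real"
    and f' :: "'x \<Rightarrow> 'x"
    and h :: "'u::{real_inner,complete_space} \<Rightarrow> ereal"
    and K :: "'x \<Rightarrow> 'u"
    and L \<mu> \<gamma> :: real
    and xs :: 'x and us :: 'u
  assumes f_convex: "convex_on UNIV f"
    and f_gradient: "\<And>x. GDERIV f x :> f' x"
    and L_pos: "L > 0"
    and f_smooth: "L-lipschitz_on UNIV f'"
    and mu_nonneg: "\<mu> \<ge> 0"
    and h_proper: "proper_fun h" and h_lsc: "lower_semicont h" and h_convex: "convex_fun h"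
    and K_linear: "bounded_linear K" and K_nonzero: "K \<noteq> (\<lambda>_. 0)"
    and lambda_pos: "lambda_min K > 0"
    and mu_le: "\<mu> \<le> L / 2"
    and primal_opt: "0 = f' xs + \<mu> *\<^sub>R xs + adjoint K us"
    and dual_opt: "K xs \<in> subdifferential (conjugate h) us"
    and gamma_pos: "\<gamma> > 0" and gamma_le: "\<gamma> \<le> 1 / (2*L)"
  shows
    "(\<forall>\<tau> a x z u v.
        \<tau> > 0 \<and> (\<forall>t\<ge>1. a t \<ge> 1) \<and> a 0 > 0
        \<and> \<gamma>*\<tau>*(onorm K)\<^sup>2 \<le> 1 + a 0*\<gamma>*\<mu>
        \<and> (\<forall>t. a (Suc t) \<ge> a t)
        \<and> apapc f' h K \<mu> \<gamma> \<tau> a x z u v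
        \<longrightarrow>
        (\<forall>t. 1 + a (Suc t)*\<gamma>*\<mu>
              \<le> (1 + a t*\<gamma>*\<mu>) * (1 + min (1/4) (1/(4*a t*\<gamma>*L)) * \<gamma>*\<tau>*lambda_min K)
          \<longrightarrow>
          energy f h K L \<mu> \<gamma> \<tau> (a (Suc t)) xs us (x (Suc t)) (z (Suc t)) (u (Suc t)) (v (Suc t))
          \<le> ereal
              (max (1 / (1 + 1/2*a t*\<gamma>*\<mu>))
              (max ((a (Suc t))\<^sup>2 / ((a t)\<^sup>2 + 1/4*(a t)\<^sup>2*\<gamma>*\<tau>*lambda_min K))
              (max ((a (Suc t))\<^sup>2 / ((a t)\<^sup>2 + 1/(4*\<gamma>*L)*a t*\<gamma>*\<tau>*lambda_min K))
                   (((a (Suc t))\<^sup>2 - a (Suc t)) / (a t)\<^sup>2))))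
            * energy f h K L \<mu> \<gamma> \<tau> (a t) xs us (x t) (z t) (u t) (v t)))
     \<and>
     (\<forall>\<nu> \<tau> a x z u v.
        0 < \<nu> \<and> \<nu> \<le> 1 \<and> \<tau> = \<nu> / (\<gamma>*(onorm K)\<^sup>2)
        \<and> a 0 = 1 \<and> a 1 = 1
        \<and> (\<forall>t\<ge>1. a (Suc t) =
              min (a t * sqrt (1 + \<nu>*lambda_min K / (4*(onorm K)\<^sup>2)))
              (min (sqrt ((a t)\<^sup>2 + a t * (\<nu>*lambda_min K / (4*\<gamma>*L*(onorm K)\<^sup>2))))
                   ((1 + sqrt (1 + 4*(a t)\<^sup>2)) / 2)))
        \<and> apapc f' h K \<mu> \<gamma> \<tau> a x z u v
        \<longrightarrow>
        (let E = (\<lambda>t. energy f h K L \<mu> \<gamma> \<tau> (a t) xs us (x t) (z t) (u t) (v t));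
             G = (\<lambda>t. lagrangian_gap f h K \<mu> xs us (x t) (u t))
         in a \<in> \<Omega>(\<lambda>t. real t / 2 * min 1 (\<nu>*lambda_min K / (4*\<gamma>*L*(onorm K)\<^sup>2)))
          \<and> (\<forall>t. E t \<le> E 0)
          \<and> (\<forall>t. G t \<le> E 0 / ereal ((a t)\<^sup>2))
          \<and> (E 0 < \<infinity> \<longrightarrow> (\<lambda>t. real_of_ereal (E 0 / ereal ((a t)\<^sup>2))) \<in> O(\<lambda>t. 1 / (real t)\<^sup>2))
          \<and> (\<exists>C::real. \<forall>\<^sub>F t in sequentially. \<bar>G t\<bar> \<le> ereal (C / (real t)\<^sup>2))
          \<and> (\<nu> < 1 \<longrightarrow> (\<lambda>t. (norm (v t - us))\<^sup>2) \<in> O(\<lambda>t. 1 / (real t)\<^sup>2))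
          \<and> (\<nu> = 1 \<longrightarrow> (\<lambda>t. (norm (v t - us))\<^sup>2) \<in> O(\<lambda>t. 1 / real t))))"
proof -
  interpret saddle_point_setting f f' h K L \<mu> \<gamma> xs us
    by (rule saddle_point_setting.intro) (fact assms)+
  show ?thesis
    unfolding Let_def
  proof (intro conjI allI impI; elim conjE)
    fix \<tau> a x z u v t
    assume \<tau>: "\<tau> > 0" and a: "\<forall>t\<ge>1. a t \<ge> 1" "a 0 > 0" "\<forall>t. a t \<le> a (Suc t)"
      and stepsize: "\<gamma>*\<tau>*(onorm K)\<^sup>2 \<le> 1 + a 0*\<gamma>*\<mu>"
      and it: "apapc f' h K \<mu> \<gamma> \<tau> a x z u v"
      and growth: "1 + a (Suc t)*\<gamma>*\<mu>
        \<le> (1 + a t*\<gamma>*\<mu>) * (1 + min (1/4) (1/(4*a t*\<gamma>*L)) * \<gamma>*\<tau>*lambda_min K)"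
    \<comment> \<open>The step size condition is given at \<open>a 0\<close>; monotone weights carry
      it to every index.\<close>
    have a0: "a 0 \<le> a t" by (rule lift_Suc_mono_le) (use a in auto)
    then have "a 0 * (\<gamma> * \<mu>) \<le> a t * (\<gamma> * \<mu>)"
      by (rule mult_right_mono) (use gamma_pos mu_nonneg in simp)
    then have "\<gamma>*\<tau>*(onorm K)\<^sup>2 \<le> 1 + a t*\<gamma>*\<mu>" using stepsize by (simp add: mult.assoc)
    with a a0 show "energy f h K L \<mu> \<gamma> \<tau> (a (Suc t)) xs us (x (Suc t)) (z (Suc t)) (u (Suc t)) (v (Suc t))
        \<le> ereal
            (max (1 / (1 + 1/2*a t*\<gamma>*\<mu>))
            (max ((a (Suc t))\<^sup>2 / ((a t)\<^sup>2 + 1/4*(a t)\<^sup>2*\<gamma>*\<tau>*lambda_min K))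
            (max ((a (Suc t))\<^sup>2 / ((a t)\<^sup>2 + 1/(4*\<gamma>*L)*a t*\<gamma>*\<tau>*lambda_min K))
                 (((a (Suc t))\<^sup>2 - a (Suc t)) / (a t)\<^sup>2))))
          * energy f h K L \<mu> \<gamma> \<tau> (a t) xs us (x t) (z t) (u t) (v t)"
      by (intro apapc_energy_contraction[OF it \<tau> _ _ _ _ growth]) (auto simp: le_max_iff_disj)
  next
    fix \<nu> \<tau> a x z u v
    assume *: "0 < \<nu>" "\<nu> \<le> 1" "\<tau> = \<nu> / (\<gamma>*(onorm K)\<^sup>2)" "a 0 = 1" "a 1 = 1"
      and rec: "\<forall>t\<ge>1. a (Suc t) =
              min (a t * sqrt (1 + \<nu>*lambda_min K / (4*(onorm K)\<^sup>2)))
              (min (sqrt ((a t)\<^sup>2 + a t * (\<nu>*lambda_min K / (4*\<gamma>*L*(onorm K)\<^sup>2))))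
                   ((1 + sqrt (1 + 4*(a t)\<^sup>2)) / 2))"
      and it: "apapc f' h K \<mu> \<gamma> \<tau> a x z u v"
    note run = * rec[rule_format] it
    show "a \<in> \<Omega>(\<lambda>t. real t / 2 * min 1 (\<nu>*lambda_min K / (4*\<gamma>*L*(onorm K)\<^sup>2)))"
      by (rule weights_bigomega[OF run])
    show "energy f h K L \<mu> \<gamma> \<tau> (a t) xs us (x t) (z t) (u t) (v t)
        \<le> energy f h K L \<mu> \<gamma> \<tau> (a 0) xs us (x 0) (z 0) (u 0) (v 0)" for t
      by (rule energy_antimono[OF run le0])
    show "lagrangian_gap f h K \<mu> xs us (x t) (u t)
        \<le> energy f h K L \<mu> \<gamma> \<tau> (a 0) xs us (x 0) (z 0) (u 0) (v 0) / ereal ((a t)\<^sup>2)" for t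
      by (rule gap_le_energy_div[OF run le0])
    show "(\<lambda>t. real_of_ereal (energy f h K L \<mu> \<gamma> \<tau> (a 0) xs us (x 0) (z 0) (u 0) (v 0) / ereal ((a t)\<^sup>2)))
        \<in> O(\<lambda>t. 1 / (real t)\<^sup>2)"
      if "energy f h K L \<mu> \<gamma> \<tau> (a 0) xs us (x 0) (z 0) (u 0) (v 0) < \<infinity>"
      by (rule energy_div_rate[OF run that])
    show "\<exists>C::real. \<forall>\<^sub>F t in sequentially.
        \<bar>lagrangian_gap f h K \<mu> xs us (x t) (u t)\<bar> \<le> ereal (C / (real t)\<^sup>2)"
      by (rule gap_rate[OF run])
    show "(\<lambda>t. (norm (v t - us))\<^sup>2) \<in> O(\<lambda>t. 1 / (real t)\<^sup>2)" if "\<nu> < 1"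
      by (rule dual_rate_strict[OF run that])
    show "(\<lambda>t. (norm (v t - us))\<^sup>2) \<in> O(\<lambda>t. 1 / real t)"
      by (rule dual_rate[OF run])
  qed
qed

end
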